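(* Let $\mathcal{D}$ be a dyadic lattice in $\mathbb{R}^d$, let $E\subset\mathbb{R}^d$ be a nonempty set and let $\gamma>0$. The porosity of $E$ is equivalent to each of the following assertions. (i) There exist constants $\alpha>0$ and $\zeta>0$ such that for each cube $R\in\mathcal{D}$ $$\sum_{Q\in\mathcal{D}_{\gamma,E}(R)}|Q|^{1-\alpha/d}\leq\zeta\,|R|^{1-\alpha/d}.$$ (ii) $|\overline{E}|=0$ and there exist constants $\alpha>0$ and $\xi>0$ such that for each cube $R\in\mathcal{D}$ $$\sum_{Q\in\mathcal{D}_{\gamma,E}(R)}\mu_{\alpha,E}(Q)\leq\xi\,\mu_{\alpha,E}(R).$$ (iii) There exists $\alpha>0$ such that for each $1\leq p<\infty$ there is a constant $C=C(\alpha,p,\gamma,E)$ such that for each cube $R\in\mathcal{D}$ and each family $\{a_Q: Q\in\mathcal{D}_{\gamma,E}(R)\}$ of non-negative scalars $$\bigg\|\sum_{Q\in\mathcal{D}_{\gamma,E}(R)}a_Q\chi_Q\bigg\|_{p,\alpha}\leq C\,\bigg\|\sup_{Q\in\mathcal{D}_{\gamma,E}(R)}a_Q\chi_Q\bigg\|_{p,\alpha}.$$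
   Context: $|A|$ denotes $d$-dimensional Lebesgue measure of $A$, $\overline{E}$ is the closure of $E$, and $\chi_Q$ is the characteristic function of $Q$. Distances are taken in the $l_\infty$-metric: $\mathrm{dist}(F,E)=\inf_{x\in F,\,y\in E}\max_{1\le i\le d}|x_i-y_i|$, and $\mathrm{dist}(x,E)=\mathrm{dist}(\{x\},E)$. A cube is a half-open set $Q=[a_1,b_1)\times\dots\times[a_d,b_d)$ with equal side lengths $\ell(Q)=b_1-a_1=\dots=b_d-a_d>0$. For a cube $R$, $\mathcal{D}(R)=\bigcup_{j\ge0}\mathcal{D}_j(R)$, where $\mathcal{D}_j(R)$ is the collection of the $2^{jd}$ pairwise disjoint half-open cubes of side length $2^{-j}\ell(R)$ whose union is $R$. A dyadic lattice $\mathcal{D}$ is a collection of cubes such that: (DL1) if $Q\in\mathcal{D}$ then $\mathcal{D}(Q)\subset\mathcal{D}$; (DL2) any two cubes $Q',Q''\in\mathcal{D}$ have a common ancestor, i.e. there is $Q\in\mathcal{D}$ with $Q',Q''\in\mathcal{D}(Q)$; (DL3) for every compact $K\subset\mathbb{R}^d$ there is a cube $Q\in\mathcal{D}$ containing $K$. $\mathcal{D}_{\gamma,E}=\{Q\in\mathcal{D}:\mathrm{dist}(Q,E)<\gamma\,\ell(Q)\}$ and $\mathcal{D}_{\gamma,E}(R)=\{Q\in\mathcal{D}_{\gamma,E}: Q\subset R\}$ for $R\in\mathcal{D}$. A cube $Q'\in\mathcal{D}$ is called free if $Q'\cap E=\varnothing$. A nonempty set $E\subset\mathbb{R}^d$ is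 porous (with respect to $\mathcal{D}$) if there is a constant $\eta>1$ such that for each $R\in\mathcal{D}$ there is a free cube $M(R)\in\mathcal{D}$, $M(R)\subset R$, with $\eta|M(R)|\ge|R|$. $\mu_{\alpha,E}$ is the weighted measure $d\mu_{\alpha,E}=\mathrm{dist}(x,E)^{-\alpha}\,dx$, i.e. $\mu_{\alpha,E}(R)=\int_R\mathrm{dist}(x,E)^{-\alpha}\,dx$, and $\|f\|_{p,\alpha}=\big(\int_{\mathbb{R}^d}|f|^p\,d\mu_{\alpha,E}\big)^{1/p}$.
   Formalization: In (ii) and (iii) the weight dist(x,E)^{-α} is additionally required to be locally integrable (μ_{α,E} finite on compact sets); without this (iii) holds for the non-porous E = R^d as ∞ ≤ ∞, and (ii) also fails to imply porosity. *)

theory Defs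
  imports "HOL-Analysis.Analysis"
begin

section \<open>Cubes\<close>

definition cube :: "real ^ 'n \<Rightarrow> real \<Rightarrow> (real ^ 'n) set" where
  "cube a l = {x. \<forall>i. a $ i \<le> x $ i \<and> x $ i < a $ i + l}"

definition is_cube :: "(real ^ 'n) set \<Rightarrow> bool" where
  "is_cube Q \<longleftrightarrow> (\<exists>a l. 0 < l \<and> Q = cube a l)"

definition side :: "(real ^ 'n) set \<Rightarrow> real" where
  "side Q = (THE l. 0 < l \<and> (\<exists>a. Q = cube a l))"

text \<open>The corner \<open>a\<close> and side length \<open>l\<close> are determined by the set (see \<open>cube_eq_iff\<close> below), so
  the following is the \<open>j\<close>-th dyadic subdivision of \<open>R\<close>: the cells of the grid that cuts each edge
  of \<open>R\<close> into \<open>2 ^ j\<close> equal pieces.\<close>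

definition subcubes :: "nat \<Rightarrow> (real ^ 'n) set \<Rightarrow> (real ^ 'n) set set" where
  "subcubes j R = {cube (\<chi> i. a $ i + real (k i) * (l / 2 ^ j)) (l / 2 ^ j) | a l k.
                     0 < l \<and> R = cube a l \<and> (\<forall>i. k i < 2 ^ j)}"

definition dyadic_subcubes :: "(real ^ 'n) set \<Rightarrow> (real ^ 'n) set set" where
  "dyadic_subcubes R = (\<Union>j. subcubes j R)"

lemma cube_eq_iff:
  fixes a a' :: "real ^ 'n"
  assumes "0 < l" "0 < l'"
  shows "cube a l = cube a' l' \<longleftrightarrow> a = a' \<and> l = l'"
proof
  have lower: "b' $ i \<le> b $ i" if "0 < m" "cube b m \<subseteq> cube b' m'"
    for b b' :: "real ^ 'n" and m m' i
  proof -
    have "b \<in> cube b m" using that(1) by (simp add: cube_def)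
    then show ?thesis using that(2) by (auto simp: cube_def)
  qed
  have upper: "m \<le> m'" if "0 < m" "0 < m'" "cube b m \<subseteq> cube b m'"
    for b :: "real ^ 'n" and m m'
  proof (rule ccontr)
    assume "\<not> m \<le> m'"
    then have "(\<chi> i. b $ i + m') \<in> cube b m" using that by (simp add: cube_def)
    then have "(\<chi> i. b $ i + m') \<in> cube b m'" using that by blast
    then show False by (simp add: cube_def)
  qed
  assume eq: "cube a l = cube a' l'"
  have "a = a'"
    using lower[of l a a' l'] lower[of l' a' a l] assms eq by (simp add: vec_eq_iff order_antisym)
  moreover from this have "l = l'"
    using upper[of l l' a] upper[of l' l a] assms eq by (simp add: order_antisym)
  ultimately show "a = a' \<and> l = l'" by simp
qed simp

lemma side_cube: "0 < l \<Longrightarrow> side (cube a l) = l"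
  unfolding side_def by (rule the_equality) (auto simp: cube_eq_iff)

lemma subcubes_cube:
  assumes "0 < l"
  shows "subcubes j (cube a l) =
    (\<lambda>k. cube (\<chi> i. a $ i + real (k i) * (l / 2 ^ j)) (l / 2 ^ j)) ` {k. \<forall>i. k i < 2 ^ j}"
  using assms unfolding subcubes_def by (auto simp: cube_eq_iff)

lemma subcubes_side:
  assumes "0 < l" "Q \<in> subcubes j (cube a l)"
  shows "is_cube Q" "side Q = l / 2 ^ j"
  using assms by (auto simp: subcubes_cube is_cube_def side_cube intro!: exI[of _ "l / 2 ^ j"])

lemma mem_subcube_iff:
  assumes "0 < l"
  shows "x \<in> cube (\<chi> i. a $ i + real (k i) * (l / 2 ^ j)) (l / 2 ^ j) \<longleftrightarrow>
    (\<forall>i. \<lfloor>(x $ i - a $ i) / (l / 2 ^ j)\<rfloor> = int (k i))"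
proof -
  have pos: "0 < l / 2 ^ j" using assms by simp
  show ?thesis
    unfolding cube_def floor_eq_iff
    by (simp add: pos_le_divide_eq[OF pos] pos_divide_less_eq[OF pos] algebra_simps
        del: divide_divide_eq_right divide_divide_eq_left times_divide_eq_right times_divide_eq_left)
qed

lemma Union_subcubes:
  assumes "0 < l"
  shows "\<Union> (subcubes j (cube a l)) = cube a l"
proof -
  define h where "h = l / 2 ^ j"
  have h: "0 < h" and l: "l = 2 ^ j * h" using assms by (auto simp: h_def)
  have "x \<in> cube a l" if "x \<in> cube (\<chi> i. a $ i + real (k i) * h) h" "\<forall>i. k i < 2 ^ j" for x k
  proof -
    have "a $ i \<le> x $ i \<and> x $ i < a $ i + l" for i
    proof -
      have "0 \<le> real (k i) * h" using h by simp
      moreover have "(real (k i) + 1) * h \<le> 2 ^ j * h"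
      proof (rule mult_right_mono)
        have "k i + 1 \<le> 2 ^ j" using that(2) by (simp add: Suc_le_eq)
        then show "real (k i) + 1 \<le> 2 ^ j"
          by (metis of_nat_1 of_nat_add of_nat_le_iff of_nat_numeral of_nat_power)
      qed (use h in simp)
      moreover have "a $ i + real (k i) * h \<le> x $ i" "x $ i < a $ i + real (k i) * h + h"
        using that(1) by (auto simp: cube_def)
      moreover have "(real (k i) + 1) * h = real (k i) * h + h" by (simp add: algebra_simps)
      ultimately show ?thesis using l by linarith
    qed
    then show ?thesis by (simp add: cube_def)
  qed
  moreover have "\<exists>k. (\<forall>i. k i < 2 ^ j) \<and> x \<in> cube (\<chi> i. a $ i + real (k i) * h) h"
    if "x \<in> cube a l" for x
  proof (intro exI conjI allI)
    let ?k = "\<lambda>i. nat \<lfloor>(x $ i - a $ i) / h\<rfloor>"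
    have nn: "0 \<le> (x $ i - a $ i) / h" for i using that h by (simp add: cube_def)
    show "?k i < 2 ^ j" for i
    proof -
      have "(x $ i - a $ i) / h < 2 ^ j"
        using that h l by (simp add: cube_def pos_divide_less_eq algebra_simps)
      then have "\<lfloor>(x $ i - a $ i) / h\<rfloor> < 2 ^ j" by (simp add: floor_less_iff)
      then show ?thesis using nn[of i] by (simp add: nat_less_iff)
    qed
    show "x \<in> cube (\<chi> i. a $ i + real (?k i) * h) h"
      using mem_subcube_iff[OF assms, of x a ?k j] nn unfolding h_def by simp
  qed
  ultimately show ?thesis
    by (auto simp: subcubes_cube[OF assms] simp flip: h_def)
qed

lemma disjoint_subcubes:
  assumes "0 < l"
  shows "disjoint (subcubes j (cube a l))"
proof (rule disjointI)
  fix P Q assume P: "P \<in> subcubes j (cube a l)" and Q: "Q \<in> subcubes j (cube a l)" and "P \<noteq> Q"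
  obtain k k' where
    k: "P = cube (\<chi> i. a $ i + real (k i) * (l / 2 ^ j)) (l / 2 ^ j)" and
    k': "Q = cube (\<chi> i. a $ i + real (k' i) * (l / 2 ^ j)) (l / 2 ^ j)"
    using P Q by (auto simp: subcubes_cube[OF assms])
  show "P \<inter> Q = {}"
  proof (rule ccontr)
    assume "P \<inter> Q \<noteq> {}"
    then obtain x where "x \<in> P" "x \<in> Q" by blast
    then have "int (k i) = int (k' i)" for i
      unfolding k k' mem_subcube_iff[OF assms] by metis
    then have "k = k'" by (intro ext) simp
    then show False using \<open>P \<noteq> Q\<close> k k' by simp
  qed
qed

section \<open>Dyadic lattices\<close>

definition dyadic_lattice :: "(real ^ 'n) set set \<Rightarrow> bool" where
  "dyadic_lattice \<D> \<longleftrightarrow>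
     (\<forall>Q\<in>\<D>. is_cube Q) \<and>
     (\<forall>Q\<in>\<D>. dyadic_subcubes Q \<subseteq> \<D>) \<and>
     (\<forall>Q'\<in>\<D>. \<forall>Q''\<in>\<D>. \<exists>Q\<in>\<D>. Q' \<in> dyadic_subcubes Q \<and> Q'' \<in> dyadic_subcubes Q) \<and>
     (\<forall>K. compact K \<longrightarrow> (\<exists>Q\<in>\<D>. K \<subseteq> Q))"

text \<open>\<^const>\<open>infnorm\<close> is the maximum norm on \<^typ>\<open>real ^ 'n\<close>.\<close>

definition set_dist :: "(real ^ 'n) set \<Rightarrow> (real ^ 'n) set \<Rightarrow> real" where
  "set_dist F E = Inf {infnorm (x - y) | x y. x \<in> F \<and> y \<in> E}"

definition near_cubes ::
  "(real ^ 'n) set set \<Rightarrow> real \<Rightarrow> (real ^ 'n) set \<Rightarrow> (real ^ 'n) set set" where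
  "near_cubes \<D> \<gamma> E = {Q \<in> \<D>. set_dist Q E < \<gamma> * side Q}"

definition near_cubes_in ::
  "(real ^ 'n) set set \<Rightarrow> real \<Rightarrow> (real ^ 'n) set \<Rightarrow> (real ^ 'n) set \<Rightarrow> (real ^ 'n) set set" where
  "near_cubes_in \<D> \<gamma> E R = {Q \<in> near_cubes \<D> \<gamma> E. Q \<subseteq> R}"

definition porous :: "(real ^ 'n) set set \<Rightarrow> (real ^ 'n) set \<Rightarrow> bool" where
  "porous \<D> E \<longleftrightarrow>
     E \<noteq> {} \<and>
     (\<exists>\<eta>>1. \<forall>R\<in>\<D>. \<exists>M\<in>\<D>. M \<subseteq> R \<and> M \<inter> E = {} \<and> \<eta> * measure lborel M \<ge> measure lborel R)"

section \<open>The weighted measure and its norms\<close>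

text \<open>The density takes the value \<open>\<infinity>\<close> where the distance to \<open>E\<close> vanishes, as \<open>inverse 0 = \<infinity>\<close> in
  \<^typ>\<open>ennreal\<close>. (Negating the exponent inside \<^const>\<open>powr\<close> would give \<open>0\<close> there.)\<close>

definition dist_measure :: "real \<Rightarrow> (real ^ 'n) set \<Rightarrow> (real ^ 'n) measure" where
  "dist_measure \<alpha> E = density lborel (\<lambda>x. inverse (ennreal (set_dist {x} E powr \<alpha>)))"

text \<open>A weight is, as usual, a locally integrable density. Without this requirement the norms below
  may be identically infinite on nonzero functions: this happens for \<open>E = UNIV\<close>, where any estimate
  between two such norms would hold as \<open>\<infinity> \<le> \<infinity>\<close>.\<close>

definition dist_weight :: "real \<Rightarrow> (real ^ 'n) set \<Rightarrow> bool" where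
  "dist_weight \<alpha> E \<longleftrightarrow> (\<forall>K. compact K \<longrightarrow> emeasure (dist_measure \<alpha> E) K < \<infinity>)"

text \<open>Powers with positive exponent on \<open>[0, \<infinity>]\<close>.\<close>

definition enn_powr :: "ennreal \<Rightarrow> real \<Rightarrow> ennreal" where
  "enn_powr x p = (if x = \<infinity> then \<infinity> else ennreal (enn2real x powr p))"

definition wnorm :: "real \<Rightarrow> real \<Rightarrow> (real ^ 'n) set \<Rightarrow> (real ^ 'n \<Rightarrow> ennreal) \<Rightarrow> ennreal" where
  "wnorm p \<alpha> E f = enn_powr (\<integral>\<^sup>+ x. enn_powr (f x) p \<partial>dist_measure \<alpha> E) (1 / p)"

end

theory Submission
  imports Defs
begin

text \<open>
  Porosity makes the neighbourhoods of \<open>E\<close> decay: passing down a fixed number of generations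
  multiplies the measure of \<open>{x \<in> R. dist(x, E) < r}\<close> by a factor less than one. Hence, for small
  \<open>\<alpha>\<close>, \<open>\<mu>(R)\<close> is at most a multiple of \<open>\<bar>R\<bar>\<close> to the power \<open>1 - \<alpha>/d\<close>. Conversely, if \<open>Q\<close> is near
  \<open>E\<close>, its deep part \<open>G(Q)\<close>, where \<open>dist(x, E)\<close> is comparable to the side of \<open>Q\<close>, has measure
  \<open>\<mu>(G(Q))\<close> at least a multiple of \<open>\<bar>Q\<bar>\<close> to the same power, and these deep parts have bounded
  overlap. This gives (i) and (ii) at once. For (iii), let \<open>t\<close> be the sum and \<open>s\<close> the supremum of
  the functions \<open>a\<^sub>Q \<chi>\<^sub>Q\<close>. Summing along the chain of cubes through \<open>x\<close> gives
  \<open>t\<^sup>p \<le> p \<Sum> a\<^sub>Q T\<^sub>Q\<^sup>p\<^sup>-\<^sup>1 \<chi>\<^sub>Q\<close> with \<open>T\<^sub>Q\<close> the sum over the cubes containing \<open>Q\<close>; after integration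
  \<open>Q\<close> may be replaced by \<open>G(Q)\<close>, so \<open>\<integral> t\<^sup>p \<le> C \<integral> s t\<^sup>p\<^sup>-\<^sup>1\<close>, and Young's inequality absorbs \<open>t\<close>.

  For the converses, if all cubes of the first \<open>K\<close> generations below \<open>R\<close> meet \<open>E\<close>, each generation
  contributes at least the value at \<open>R\<close> to the sums in (i) and (ii), which bounds \<open>K\<close>; (iii) with
  \<open>p = 1\<close> and \<open>a\<^sub>Q = 1\<close> contains the estimate of (ii).
\<close>

section \<open>Cubes and their subdivisions\<close>

lemma cube_borel [measurable]: "cube (a :: real ^ 'n) l \<in> sets borel"
proof -
  have "cube a l = (\<Inter>i. {x. a $ i \<le> x $ i} \<inter> {x. x $ i < a $ i + l})"
    by (auto simp: cube_def)
  moreover have "{x::real^'n. a $ i \<le> x $ i} \<inter> {x. x $ i < a $ i + l} \<in> sets borel" for i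
    by (intro sets.Int borel_closed borel_open closed_halfspace_component_ge_cart
        open_halfspace_component_lt_cart)
  ultimately show ?thesis by auto
qed

text \<open>The half-open cube lies between an open and a closed box with the same corners, and
  these two have equal measure.\<close>

lemma emeasure_cube:
  fixes a :: "real ^ 'n"
  assumes "0 < l"
  shows "emeasure lborel (cube a l) = ennreal (l ^ CARD('n))"
proof (rule antisym)
  define b where "b = (\<chi> i. a $ i + l)"
  have le: "a \<bullet> i \<le> b \<bullet> i" if "i \<in> Basis" for i
    using that assms by (auto simp: b_def Basis_vec_def inner_axis)
  have "measure lborel (cbox a b) = l ^ CARD('n)"
    using assms by (subst content_cbox_cart) (auto simp: b_def interval_ne_empty_cart less_imp_le)
  then have cb: "emeasure lborel (cbox a b) = ennreal (l ^ CARD('n))"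
    using emeasure_eq_ennreal_measure[of lborel "cbox a b"] emeasure_lborel_cbox_finite[of a b] by simp
  then have bx: "emeasure lborel (box a b) = ennreal (l ^ CARD('n))"
    using le by (simp add: emeasure_lborel_box_eq emeasure_lborel_cbox_eq)
  have "cube a l \<subseteq> cbox a b" "box a b \<subseteq> cube a l"
    by (auto simp: cube_def b_def mem_box_cart less_imp_le)
  then show "emeasure lborel (cube a l) \<le> ennreal (l ^ CARD('n))"
    "ennreal (l ^ CARD('n)) \<le> emeasure lborel (cube a l)"
    using emeasure_mono[of "cube a l" "cbox a b" lborel] emeasure_mono[of "box a b" "cube a l" lborel]
      cb bx by (auto simp: cube_borel)
qed

lemma is_cubeE:
  assumes "is_cube Q"
  obtains a l where "0 < l" "Q = cube a l" "side Q = l"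
  using assms by (auto simp: is_cube_def side_cube)

lemma side_pos: "is_cube Q \<Longrightarrow> 0 < side Q"
  by (auto elim: is_cubeE)

lemma is_cube_borel: "is_cube Q \<Longrightarrow> Q \<in> sets borel"
  by (auto simp: is_cube_def)

lemma is_cube_emeasure: "is_cube Q \<Longrightarrow> emeasure lborel Q = ennreal (side Q ^ CARD('n))"
  for Q :: "(real ^ 'n) set"
  by (auto elim!: is_cubeE simp: emeasure_cube)

lemma is_cube_measure: "is_cube Q \<Longrightarrow> measure lborel Q = side Q ^ CARD('n)"
  for Q :: "(real ^ 'n) set"
  by (simp add: measure_def is_cube_emeasure side_pos less_imp_le)

lemma is_cube_nonempty:
  assumes "is_cube Q"
  shows "Q \<noteq> {}"
proof -
  obtain a l where "0 < l" "Q = cube a l" using assms by (rule is_cubeE)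
  then have "a \<in> Q" by (simp add: cube_def)
  then show ?thesis by blast
qed

lemma infnorm_le_cart: "(\<And>i. \<bar>x $ i\<bar> \<le> r) \<Longrightarrow> infnorm x \<le> r" for x :: "real ^ 'n"
  unfolding infnorm_cart by (rule cSup_least) auto

lemma is_cube_infnorm:
  assumes "is_cube Q" "x \<in> Q" "y \<in> Q"
  shows "infnorm (x - y) \<le> side Q"
proof -
  obtain a where "Q = cube a (side Q)" using assms(1) by (auto elim: is_cubeE)
  then have "a $ i \<le> x $ i \<and> x $ i < a $ i + side Q" "a $ i \<le> y $ i \<and> y $ i < a $ i + side Q" for i
    using assms unfolding cube_def by blast+
  then show ?thesis
    by (intro infnorm_le_cart) (simp add: abs_le_iff, smt (verit))
qed

lemma finite_subcubes: "is_cube R \<Longrightarrow> finite (subcubes j R)"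
proof -
  assume "is_cube R"
  then obtain a l where R: "0 < l" "R = cube a l" by (rule is_cubeE)
  have "{k :: 'a \<Rightarrow> nat. \<forall>i. k i < 2 ^ j} = PiE UNIV (\<lambda>_. {..<2 ^ j})"
    by auto
  then have "finite {k :: 'a \<Rightarrow> nat. \<forall>i. k i < 2 ^ j}"
    by (simp add: finite_PiE)
  then show ?thesis
    by (simp add: subcubes_cube R)
qed

lemma subcubes_props:
  assumes "is_cube R" "Q \<in> subcubes j R"
  shows "is_cube Q" "side Q = side R / 2 ^ j" "Q \<subseteq> R"
proof -
  obtain a l where R: "0 < l" "R = cube a l" "side R = l" using assms(1) by (rule is_cubeE)
  have Q: "Q \<in> subcubes j (cube a l)" using assms R by simp
  show "is_cube Q" "side Q = side R / 2 ^ j"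
    using subcubes_side[OF R(1) Q] R(3) by auto
  show "Q \<subseteq> R" using Q Union_subcubes[OF R(1), of j a] R(2) by blast
qed

lemma is_cube_Union_subcubes: "is_cube R \<Longrightarrow> \<Union> (subcubes j R) = R"
  by (erule is_cubeE) (simp add: Union_subcubes)

lemma is_cube_disjoint_subcubes: "is_cube R \<Longrightarrow> disjoint (subcubes j R)"
  by (auto elim!: is_cubeE simp: disjoint_subcubes)

lemma sum_emeasure_subcubes:
  assumes "is_cube R" "sets M = sets borel"
  shows "(\<Sum>Q\<in>subcubes j R. emeasure M Q) = emeasure M R"
proof -
  have "(\<Sum>Q\<in>subcubes j R. emeasure M Q) = emeasure M (\<Union> (subcubes j R))"
    using sum_emeasure[of "\<lambda>Q. Q" "subcubes j R" M] assms is_cube_disjoint_subcubes[OF assms(1)]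
    by (auto simp: finite_subcubes disjoint_family_on_def disjoint_def
        intro: is_cube_borel subcubes_props(1))
  then show ?thesis using assms by (simp add: is_cube_Union_subcubes)
qed

text \<open>Grid indices compose like digits: cell \<open>k'\<close> inside cell \<open>k\<close>
  has index \<open>k n * 2 ^ j + k' n\<close> in the finer grid of \<open>P\<close>.\<close>

lemma subcubes_trans:
  assumes "is_cube P" "R \<in> subcubes i P" "Q \<in> subcubes j R"
  shows "Q \<in> subcubes (i + j) P"
proof -
  obtain a l where l: "0 < l" "P = cube a l" using assms(1) by (rule is_cubeE)
  define h where "h = l / 2 ^ (i + j)"
  have h: "l / 2 ^ i = 2 ^ j * h" "l / 2 ^ i / 2 ^ j = h" by (auto simp: h_def power_add)
  obtain k where k: "\<And>n. k n < 2 ^ i" "R = cube (\<chi> n. a $ n + real (k n) * (l / 2 ^ i)) (l / 2 ^ i)"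
    using assms(2) unfolding l(2) subcubes_cube[OF l(1)] by auto
  have pos: "0 < l / 2 ^ i" using l by simp
  obtain k' where k': "\<And>n. k' n < 2 ^ j"
    "Q = cube (\<chi> n. (\<chi> n. a $ n + real (k n) * (l / 2 ^ i)) $ n + real (k' n) * (l / 2 ^ i / 2 ^ j)) (l / 2 ^ i / 2 ^ j)"
    using assms(3) unfolding k(2) subcubes_cube[OF pos] by auto
  have "Q = cube (\<chi> n. a $ n + real (k n * 2 ^ j + k' n) * h) h"
    unfolding k'(2) h by (simp add: algebra_simps)
  moreover have "k n * 2 ^ j + k' n < 2 ^ (i + j)" for n
  proof -
    \<comment> \<open>The bound is needed for \<open>k n + 1\<close>, since the block of
      \<open>k n\<close> still has room for the remainder \<open>k' n < 2 ^ j\<close>.\<close>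
    have "(k n + 1) * 2 ^ j \<le> 2 ^ i * 2 ^ j" using k(1)[of n] by (intro mult_right_mono) auto
    then show ?thesis using k'(1)[of n] by (simp add: power_add)
  qed
  ultimately show ?thesis
    unfolding l(2) subcubes_cube[OF l(1)] h_def by (intro image_eqI) auto
qed

text \<open>A common point selects a cell \<open>Q'\<close> of \<open>R\<close> in generation
  \<open>j - i\<close>. Counted from \<open>P\<close> this cell has generation \<open>j\<close>, and
  disjointness of that generation identifies it with \<open>Q\<close>.\<close>

lemma subcubes_nested:
  assumes "is_cube P" "R \<in> subcubes i P" "Q \<in> subcubes j P" "i \<le> j" "Q \<inter> R \<noteq> {}"
  shows "Q \<in> subcubes (j - i) R"
proof -
  obtain x where x: "x \<in> Q" "x \<in> R" using assms by blast
  have R: "is_cube R" using assms subcubes_props by blast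
  obtain Q' where Q': "x \<in> Q'" "Q' \<in> subcubes (j - i) R"
    using is_cube_Union_subcubes[OF R] x(2) by blast
  have "Q' \<in> subcubes j P" using subcubes_trans[OF assms(1,2) Q'(2)] assms(4) by simp
  then have "Q' = Q"
    using is_cube_disjoint_subcubes[OF assms(1), of j] assms(3) Q'(1) x(1)
    unfolding disjoint_def by blast
  then show ?thesis using Q' by simp
qed

text \<open>Equal sides force generation zero, whose only cell is the cube itself.\<close>

lemma same_side_subset_eq: 
  assumes "is_cube Q" "is_cube Q'" "Q \<in> subcubes j Q'" "side Q = side Q'"
  shows "Q = Q'"
proof -
  have "side Q' = side Q' / 2 ^ j" using subcubes_props[OF assms(2,3)] assms(4) by simp
  then have "(2::real) ^ j = 1" using side_pos[OF assms(2)] by (simp add: field_simps)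
  then have "j = 0" using one_less_power[of "2::real" j] by (cases "j = 0") auto
  obtain a l where a: "0 < l" "Q' = cube a l" using assms(2) by (rule is_cubeE)
  have "subcubes 0 (cube a l) = {cube a l}"
    unfolding subcubes_cube[OF a(1)] by auto
  with a assms(3) \<open>j = 0\<close> show ?thesis by (metis singletonD)
qed

section \<open>Nesting of cubes in a dyadic lattice\<close>

locale lattice_of_cubes =
  fixes \<D> :: "(real ^ 'n) set set"
  assumes dyadic: "dyadic_lattice \<D>"
begin

lemma cube_mem: "Q \<in> \<D> \<Longrightarrow> is_cube Q"
  using dyadic by (simp add: dyadic_lattice_def)

lemma subcubes_mem: "R \<in> \<D> \<Longrightarrow> Q \<in> subcubes j R \<Longrightarrow> Q \<in> \<D>"
  using dyadic unfolding dyadic_lattice_def dyadic_subcubes_def by blast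

lemma compact_covered: "compact K \<Longrightarrow> \<exists>Q\<in>\<D>. K \<subseteq> Q"
  using dyadic by (simp add: dyadic_lattice_def)

text \<open>By (DL2) both cubes are cells of a common ancestor. The one of the later generation
  there is a cell of the other.\<close>

lemma nested:
  assumes "Q \<in> \<D>" "Q' \<in> \<D>" "Q \<inter> Q' \<noteq> {}"
  obtains j where "Q \<in> subcubes j Q'" | j where "Q' \<in> subcubes j Q"
proof -
  have "\<exists>P\<in>\<D>. Q \<in> dyadic_subcubes P \<and> Q' \<in> dyadic_subcubes P"
    using dyadic assms(1,2) unfolding dyadic_lattice_def by metis
  then obtain P i j where "P \<in> \<D>" and P: "Q \<in> subcubes i P" "Q' \<in> subcubes j P"
    unfolding dyadic_subcubes_def by auto
  have "is_cube P" using cube_mem \<open>P \<in> \<D>\<close> .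
  show thesis
  proof (cases "i \<le> j")
    case True
    have "Q' \<in> subcubes (j - i) Q"
      using subcubes_nested[OF \<open>is_cube P\<close> P True] assms(3) by (simp add: Int_commute)
    then show thesis by (rule that(2))
  next
    case False
    have "Q \<in> subcubes (i - j) Q'"
      using subcubes_nested[OF \<open>is_cube P\<close> P(2,1) _ assms(3)] False by simp
    then show thesis by (rule that(1))
  qed
qed

lemma comparable:
  assumes "Q \<in> \<D>" "Q' \<in> \<D>" "x \<in> Q" "x \<in> Q'"
  shows "Q \<subseteq> Q' \<or> Q' \<subseteq> Q"
proof (rule nested[OF assms(1,2)])
  show "Q \<inter> Q' \<noteq> {}" using assms by blast
  show "Q \<subseteq> Q' \<or> Q' \<subseteq> Q" if "Q \<in> subcubes j Q'" for j
    using subcubes_props(3)[OF cube_mem[OF assms(2)] that] by simp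
  show "Q \<subseteq> Q' \<or> Q' \<subseteq> Q" if "Q' \<in> subcubes j Q" for j
    using subcubes_props(3)[OF cube_mem[OF assms(1)] that] by simp
qed

lemma subset_level:
  assumes "Q \<in> \<D>" "R \<in> \<D>" "Q \<subseteq> R"
  obtains j where "Q \<in> subcubes j R"
proof -
  have "Q \<inter> R \<noteq> {}" using assms is_cube_nonempty[OF cube_mem[OF assms(1)]] by blast
  then show thesis
  proof (rule nested[OF assms(1,2)])
    \<comment> \<open>In the reverse case the two inclusions give \<open>R = Q\<close>, so the same
      \<open>j\<close> serves.\<close>
    fix j assume "R \<in> subcubes j Q"
    moreover from this have "R = Q"
      using assms(3) subcubes_props(3)[OF cube_mem[OF assms(1)]] by (intro antisym)
    ultimately have "Q \<in> subcubes j R" by simp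
    then show thesis by (rule that)
  qed (rule that)
qed

lemma eq_of_side:
  assumes "Q \<in> \<D>" "Q' \<in> \<D>" "x \<in> Q" "x \<in> Q'" "side Q = side Q'"
  shows "Q = Q'"
proof (rule nested[OF assms(1,2)])
  show "Q \<inter> Q' \<noteq> {}" using assms by blast
  show "Q = Q'" if "Q \<in> subcubes j Q'" for j
    using same_side_subset_eq[OF cube_mem cube_mem that] assms by simp
  show "Q = Q'" if "Q' \<in> subcubes j Q" for j
    using same_side_subset_eq[OF cube_mem cube_mem that] assms by simp
qed

end

section \<open>Distances and the weighted measure\<close>

lemma bdd_below_set_dist: "bdd_below {infnorm (x - y) | x y. x \<in> F \<and> y \<in> E}"
  by (rule bdd_belowI[of _ 0]) (auto simp: infnorm_pos_le)

lemma set_dist_le: "x \<in> F \<Longrightarrow> y \<in> E \<Longrightarrow> set_dist F E \<le> infnorm (x - y)"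
  unfolding set_dist_def by (rule cInf_lower) (auto simp: bdd_below_set_dist)

lemma set_dist_greatest:
  assumes "F \<noteq> {}" "E \<noteq> {}" "\<And>x y. x \<in> F \<Longrightarrow> y \<in> E \<Longrightarrow> r \<le> infnorm (x - y)"
  shows "r \<le> set_dist F E"
  unfolding set_dist_def using assms by (intro cInf_greatest) auto

lemma set_dist_nonneg: "F \<noteq> {} \<Longrightarrow> E \<noteq> {} \<Longrightarrow> 0 \<le> set_dist F E"
  by (rule set_dist_greatest) (auto simp: infnorm_pos_le)

text \<open>Since \<open>r\<close> bounds the distance from \<open>x\<close> to every point of
  \<open>F\<close>, it does not matter which point of \<open>F\<close> nearly realizes the distance
  to \<open>E\<close>. The two uses are \<open>F\<close> a cube containing \<open>x\<close> and
  \<open>F\<close> a single point.\<close>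

lemma set_dist_triangle:
  assumes "E \<noteq> {}" "F \<noteq> {}" "\<And>y. y \<in> F \<Longrightarrow> infnorm (x - y) \<le> r"
  shows "set_dist {x} E \<le> r + set_dist F E"
proof -
  have "set_dist {x} E - r \<le> set_dist F E"
  proof (rule set_dist_greatest)
    fix y z assume "y \<in> F" "z \<in> E"
    have "set_dist {x} E \<le> infnorm (x - z)" using \<open>z \<in> E\<close> by (intro set_dist_le) auto
    also have "\<dots> \<le> infnorm (x - y) + infnorm (y - z)"
      using infnorm_triangle[of "x - y" "y - z"] by simp
    finally show "set_dist {x} E - r \<le> infnorm (y - z)" using assms(3)[OF \<open>y \<in> F\<close>] by simp
  qed (use assms in auto)
  then show ?thesis by simp
qed

lemma set_dist_point_le_cube:
  "is_cube Q \<Longrightarrow> x \<in> Q \<Longrightarrow> E \<noteq> {} \<Longrightarrow> set_dist {x} E \<le> side Q + set_dist Q E"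
  by (rule set_dist_triangle) (auto simp: is_cube_infnorm)

lemma continuous_on_point_dist:
  fixes E :: "(real ^ 'n) set"
  assumes "E \<noteq> {}"
  shows "continuous_on UNIV (\<lambda>x. set_dist {x} E)"
proof (rule continuous_onI)
  fix e :: real and y :: "real ^ 'n" assume "0 < e"
  have "dist (set_dist {z} E) (set_dist {y} E) \<le> e" if "dist z y < e" for z
  proof -
    have "set_dist {z} E \<le> infnorm (z - y) + set_dist {y} E"
      "set_dist {y} E \<le> infnorm (z - y) + set_dist {z} E"
      using assms by (auto intro!: set_dist_triangle simp: infnorm_sub)
    moreover have "infnorm (z - y) < e"
      using that infnorm_le_norm[of "z - y"] by (simp add: dist_norm)
    ultimately show ?thesis by (simp add: dist_real_def)
  qed
  then show "\<exists>d>0. \<forall>z\<in>UNIV. dist z y < d \<longrightarrow> dist (set_dist {z} E) (set_dist {y} E) \<le> e"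
    using \<open>0 < e\<close> by auto
qed

lemma point_dist_measurable [measurable]:
  "E \<noteq> {} \<Longrightarrow> (\<lambda>x. set_dist {x} E) \<in> borel_measurable borel"
  by (intro borel_measurable_continuous_onI continuous_on_point_dist)

lemma point_dist_closure:
  assumes "x \<in> closure E"
  shows "set_dist {x} E = 0"
proof (rule antisym)
  have "E \<noteq> {}" using assms by auto
  then show "0 \<le> set_dist {x} E" by (simp add: set_dist_nonneg)
  show "set_dist {x} E \<le> 0"
  proof (rule field_le_epsilon)
    fix e :: real assume "0 < e"
    then obtain y where "y \<in> E" "dist y x < e" using assms closure_approachable by blast
    then show "set_dist {x} E \<le> 0 + e"
      using set_dist_le[of x "{x}" y E] infnorm_le_norm[of "x - y"]
      by (simp add: dist_norm norm_minus_commute)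
  qed
qed

section \<open>The density of the weighted measure and its bounds\<close>

definition dist_dens :: "real \<Rightarrow> (real ^ 'n) set \<Rightarrow> real ^ 'n \<Rightarrow> ennreal" where
  "dist_dens \<alpha> E x = inverse (ennreal (set_dist {x} E powr \<alpha>))"

lemma dist_measure_eq: "dist_measure \<alpha> E = density lborel (dist_dens \<alpha> E)"
  by (simp add: dist_measure_def dist_dens_def[abs_def])

lemma dist_dens_measurable [measurable]:
  assumes [measurable]: "E \<noteq> {}"
  shows "dist_dens \<alpha> E \<in> borel_measurable borel"
  unfolding dist_dens_def[abs_def] using assms by measurable

lemma sets_dist_measure [simp, measurable_cong]: "sets (dist_measure \<alpha> E) = sets borel"
  by (simp add: dist_measure_def)

lemma emeasure_dist_measure:
  "E \<noteq> {} \<Longrightarrow> A \<in> sets borel \<Longrightarrow>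
    emeasure (dist_measure \<alpha> E) A = (\<integral>\<^sup>+ x. dist_dens \<alpha> E x * indicator A x \<partial>lborel)"
  unfolding dist_measure_eq by (rule emeasure_density) auto

lemma dist_dens_zero: "set_dist {x} E = 0 \<Longrightarrow> dist_dens \<alpha> E x = \<infinity>"
  by (simp add: dist_dens_def)

lemma dist_dens_pos: "0 < dist_dens \<alpha> E x"
  by (simp add: dist_dens_def ennreal_inverse_positive)

lemma dist_dens_eq: "0 < set_dist {x} E \<Longrightarrow> dist_dens \<alpha> E x = ennreal (set_dist {x} E powr - \<alpha>)"
  by (simp add: dist_dens_def inverse_ennreal powr_minus)

text \<open>At distance zero the density is \<open>\<infinity>\<close> and the bound is trivial;
  elsewhere powers with negative exponent decrease.\<close>

lemma dist_dens_ge: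
  assumes "E \<noteq> {}" "0 < \<alpha>" "0 < r" "set_dist {x} E \<le> r"
  shows "ennreal (r powr - \<alpha>) \<le> dist_dens \<alpha> E x"
proof (cases "set_dist {x} E = 0")
  case False
  then have "0 < set_dist {x} E" using set_dist_nonneg[of "{x}" E] assms by simp
  then show ?thesis
    using assms by (simp add: dist_dens_eq ennreal_leI powr_mono2')
qed (simp add: dist_dens_zero)

lemma dist_dens_le:
  assumes "0 < \<alpha>" "0 < r" "r \<le> set_dist {x} E"
  shows "dist_dens \<alpha> E x \<le> ennreal (r powr - \<alpha>)"
  using assms by (simp add: dist_dens_eq ennreal_leI powr_mono2')

text \<open>The density vanishes nowhere, so a zero integral over \<open>A\<close> would make
  \<open>A\<close> a Lebesgue null set.\<close>

lemma dist_measure_pos: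
  assumes "E \<noteq> {}" "A \<in> sets borel" "0 < emeasure lborel A"
  shows "0 < emeasure (dist_measure \<alpha> E) A"
proof -
  have "\<not> (AE x in lborel. dist_dens \<alpha> E x * indicator A x = 0)"
  proof
    assume "AE x in lborel. dist_dens \<alpha> E x * indicator A x = 0"
    then have "AE x in lborel. x \<notin> A"
      by eventually_elim (auto simp: indicator_def dist_dens_pos[THEN less_imp_neq, symmetric])
    then have "emeasure lborel A = 0"
      using assms(2) by (subst (asm) AE_iff_measurable[of A]) auto
    with assms(3) show False by simp
  qed
  moreover have "(\<lambda>x. dist_dens \<alpha> E x * indicator A x) \<in> borel_measurable lborel"
    using assms by measurable
  ultimately have "(\<integral>\<^sup>+ x. dist_dens \<alpha> E x * indicator A x \<partial>lborel) \<noteq> 0"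
    by (subst nn_integral_0_iff_AE) auto
  then show ?thesis
    using assms by (simp add: emeasure_dist_measure zero_less_iff_neq_zero)
qed

lemma is_cube_bounded: "is_cube (Q :: (real ^ 'n) set) \<Longrightarrow> \<exists>K. compact K \<and> Q \<subseteq> K"
proof (elim is_cubeE)
  fix a :: "real ^ 'n" and l assume "Q = cube a l"
  then have "Q \<subseteq> cbox a (\<chi> i. a $ i + l)" by (auto simp: cube_def mem_box_cart less_imp_le)
  then show ?thesis by (meson compact_cbox)
qed

text \<open>A half-open cube is not compact, so local integrability is applied to a compact box
  around it.\<close>

lemma dist_weight_cube_finite:
  assumes "dist_weight \<alpha> E" "is_cube Q"
  shows "emeasure (dist_measure \<alpha> E) Q < \<infinity>"
proof -
  obtain K where "compact K" "Q \<subseteq> K" using is_cube_bounded[OF assms(2)] by blast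
  then have "emeasure (dist_measure \<alpha> E) Q \<le> emeasure (dist_measure \<alpha> E) K"
    by (intro emeasure_mono) (auto simp: borel_compact)
  also have "\<dots> < \<infinity>" using assms(1) \<open>compact K\<close> by (simp add: dist_weight_def)
  finally show ?thesis .
qed

section \<open>Sums over near cubes\<close>

lemma ennreal_term_le_suminf: "f j \<le> suminf f" for f :: "nat \<Rightarrow> ennreal"
  using sum_le_suminf[of f "{j}"] by simp

lemma ennreal_infsum_leI:
  fixes f :: "'a \<Rightarrow> ennreal"
  assumes "\<And>F. finite F \<Longrightarrow> F \<subseteq> A \<Longrightarrow> sum f F \<le> b"
  shows "infsum f A \<le> b"
  using assms by (subst nonneg_infsum_complete) (auto intro!: SUP_least)

lemma ennreal_sum_le_infsum:
  fixes f :: "'a \<Rightarrow> ennreal"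
  assumes "finite F" "F \<subseteq> A"
  shows "sum f F \<le> infsum f A"
  using assms by (subst nonneg_infsum_complete) (auto intro!: SUP_upper)

context lattice_of_cubes begin

text \<open>A cube that meets \<open>E\<close> has distance zero from it and is therefore near.
  Generations \<open>0\<close> to \<open>K\<close> thus all occur in the near sum; they are disjoint
  collections because their sides differ, and each contributes at least \<open>w R\<close>.\<close>

lemma sum_le_near_sum:
  fixes w :: "(real ^ 'n) set \<Rightarrow> ennreal"
  assumes "R \<in> \<D>" "0 < \<gamma>"
    and hit: "\<And>k Q. k \<le> K \<Longrightarrow> Q \<in> subcubes k R \<Longrightarrow> Q \<inter> E \<noteq> {}"
    and w: "\<And>k. w R \<le> (\<Sum>Q\<in>subcubes k R. w Q)"
  shows "of_nat (Suc K) * w R \<le> (\<Sum>\<^sub>\<infinity>Q\<in>near_cubes_in \<D> \<gamma> E R. w Q)"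
proof -
  have R: "is_cube R" using assms cube_mem by blast
  have "of_nat (Suc K) * w R = (\<Sum>k\<le>K. w R)" by simp
  also have "\<dots> \<le> (\<Sum>k\<le>K. \<Sum>Q\<in>subcubes k R. w Q)" by (intro sum_mono w)
  also have "\<dots> = (\<Sum>Q\<in>(\<Union>k\<in>{..K}. subcubes k R). w Q)"
  proof (rule sum.UNION_disjoint[symmetric])
    show "\<forall>i\<in>{..K}. \<forall>j\<in>{..K}. i \<noteq> j \<longrightarrow> subcubes i R \<inter> subcubes j R = {}"
    proof (intro ballI impI)
      fix i j :: nat assume "i \<noteq> j"
      have "side R / 2 ^ i \<noteq> side R / 2 ^ j" using side_pos[OF R] \<open>i \<noteq> j\<close> by simp
      then show "subcubes i R \<inter> subcubes j R = {}" 
        using subcubes_props(2)[OF R, of _ i] subcubes_props(2)[OF R, of _ j] by fastforce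
    qed
  qed (auto simp: finite_subcubes R)
  also have "\<dots> \<le> (\<Sum>\<^sub>\<infinity>Q\<in>near_cubes_in \<D> \<gamma> E R. w Q)"
  proof (rule ennreal_sum_le_infsum)
    show "(\<Union>k\<in>{..K}. subcubes k R) \<subseteq> near_cubes_in \<D> \<gamma> E R"
    proof clarify
      fix k Q assume kQ: "k \<le> K" "Q \<in> subcubes k R"
      then obtain x where "x \<in> Q" "x \<in> E" using hit by blast
      then have "set_dist Q E \<le> 0" using set_dist_le[of x Q x E] by (simp add: infnorm_0)
      moreover have "is_cube Q" "Q \<subseteq> R" using subcubes_props[OF R kQ(2)] by auto
      ultimately show "Q \<in> near_cubes_in \<D> \<gamma> E R"
        using subcubes_mem[OF assms(1) kQ(2)] side_pos[of Q] assms(2)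
        unfolding near_cubes_in_def near_cubes_def by (auto intro: le_less_trans)
    qed
  qed (auto simp: finite_subcubes R)
  finally show ?thesis .
qed

text \<open>The common core of the converses, applied with \<open>w\<close> a power of the volume or
  the weighted measure. If no cube of generations \<open>0\<close> to \<open>K\<close> were free,
  \<open>w R\<close> could be cancelled, being positive and finite, to give
  \<open>K + 1 \<le> max 0 C\<close>. So a free cube occurs within \<open>K\<close>
  generations.\<close>

lemma porous_of_near_sum_le:
  fixes w :: "(real ^ 'n) set \<Rightarrow> ennreal"
  assumes "E \<noteq> {}" "0 < \<gamma>"
    and w_pos: "\<And>R. R \<in> \<D> \<Longrightarrow> 0 < w R" and w_fin: "\<And>R. R \<in> \<D> \<Longrightarrow> w R < \<infinity>"
    and w: "\<And>R k. R \<in> \<D> \<Longrightarrow> w R \<le> (\<Sum>Q\<in>subcubes k R. w Q)"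
    and le: "\<And>R. R \<in> \<D> \<Longrightarrow> (\<Sum>\<^sub>\<infinity>Q\<in>near_cubes_in \<D> \<gamma> E R. w Q) \<le> ennreal C * w R"
  shows "porous \<D> E"
proof -
  define K where "K = nat \<lceil>C\<rceil>"
  \<comment> \<open>A cube of generation at most \<open>K\<close> has at least the fraction
    \<open>1 / (2 ^ K) ^ d\<close> of the volume of \<open>R\<close>. Adding 1 makes
    \<open>\<eta> > 1\<close> strict even for \<open>K = 0\<close>.\<close>
  define \<eta> :: real where "\<eta> = (2 ^ K) ^ CARD('n) + 1"
  have "\<exists>M\<in>\<D>. M \<subseteq> R \<and> M \<inter> E = {} \<and> \<eta> * measure lborel M \<ge> measure lborel R" if R: "R \<in> \<D>" for R
  proof -
    have cR: "is_cube R" using R by (rule cube_mem)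
    have "\<exists>k Q. k \<le> K \<and> Q \<in> subcubes k R \<and> Q \<inter> E = {}"
    proof (rule ccontr)
      assume "\<not> ?thesis"
      then have "of_nat (Suc K) * w R \<le> (\<Sum>\<^sub>\<infinity>Q\<in>near_cubes_in \<D> \<gamma> E R. w Q)"
        by (intro sum_le_near_sum R \<open>0 < \<gamma>\<close> w) blast
      also have "\<dots> \<le> ennreal C * w R" using R by (rule le)
      finally have le': "of_nat (Suc K) * w R \<le> ennreal C * w R" .
      obtain r where r: "w R = ennreal r" "0 < r"
        using w_pos[OF R] w_fin[OF R] by (cases "w R") auto
      \<comment> \<open>\<open>C\<close> may be negative; \<open>ennreal\<close> then truncates it
        to zero, whence \<open>max 0 C\<close>.\<close>
      have "ennreal (real (Suc K) * r) \<le> ennreal (max 0 C * r)"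
        using le' r by (simp add: ennreal_mult' ennreal_max_0 flip: ennreal_of_nat_eq_real_of_nat)
      then have "real (Suc K) \<le> max 0 C" using r(2) by simp
      moreover have "max 0 C \<le> real K" unfolding K_def by linarith
      ultimately show False by simp
    qed
    then obtain k Q where Q: "k \<le> K" "Q \<in> subcubes k R" "Q \<inter> E = {}" by blast
    have side: "is_cube Q" "side R = 2 ^ k * side Q" "Q \<subseteq> R"
      using subcubes_props[OF cR Q(2)] by auto
    have "measure lborel R = (2 ^ k) ^ CARD('n) * measure lborel Q"
      using side cR by (simp add: is_cube_measure power_mult_distrib)
    also have "\<dots> \<le> \<eta> * measure lborel Q"
      using power_mono[of "2 ^ k :: real" "2 ^ K" "CARD('n)"] Q(1)
      unfolding \<eta>_def by (intro mult_right_mono) (auto simp: power_increasing add_increasing2)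
    finally show ?thesis using subcubes_mem[OF R Q(2)] Q(3) side(3) by blast
  qed
  moreover have "1 < \<eta>" by (simp add: \<eta>_def)
  ultimately show ?thesis unfolding porous_def using assms(1) by blast
qed

end

section \<open>Porous sets\<close>

lemma is_cube_measure_powr:
  fixes Q :: "(real ^ 'n) set"
  assumes "is_cube Q"
  shows "measure lborel Q powr (1 - \<alpha> / real CARD('n)) = side Q powr (real CARD('n) - \<alpha>)"
proof -
  have "measure lborel Q = side Q powr real CARD('n)"
    using assms by (simp add: is_cube_measure powr_realpow side_pos)
  then show ?thesis by (simp add: powr_powr right_diff_distrib)
qed

section \<open>Deep parts of cubes and the decay of neighbourhoods of \<open>E\<close>\<close>

locale porous_lattice = lattice_of_cubes \<D> for \<D> :: "(real ^ 'n) set set" +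
  fixes E :: "(real ^ 'n) set" and \<eta> :: real
  assumes E_nonempty: "E \<noteq> {}" and \<eta>: "1 < \<eta>"
    and free_subcube:
      "R \<in> \<D> \<Longrightarrow> \<exists>M\<in>\<D>. M \<subseteq> R \<and> M \<inter> E = {} \<and> measure lborel R \<le> \<eta> * measure lborel M"
begin

text \<open>The threshold fits the free cube of \<open>Q\<close>: its side is at least
  \<open>side Q / \<eta>\<close>, and the points of its concentric half are at least a quarter of
  that side away from \<open>E\<close>.\<close>

definition deep :: "(real ^ 'n) set \<Rightarrow> (real ^ 'n) set" where
  "deep Q = {x \<in> Q. side Q / (4 * \<eta>) \<le> set_dist {x} E}"

text \<open>The proportion of a cube filled by the concentric half of its free cube:
  \<open>1 / \<eta>\<close> for the free cube, \<open>1 / 2 ^ d\<close> for the halving.\<close>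

definition \<kappa> :: real where
  "\<kappa> = 1 / (\<eta> * 2 ^ CARD('n))"

lemma \<kappa>: "0 < \<kappa>" "\<kappa> < 1"
proof -
  show "0 < \<kappa>" using \<eta> by (simp add: \<kappa>_def)
  have "1 * 1 < \<eta> * 2 ^ CARD('n)" using \<eta> by (intro mult_strict_mono) auto
  then show "\<kappa> < 1" by (simp add: \<kappa>_def)
qed

lemma level_sets_borel:
  assumes "is_cube Q"
  shows "{x \<in> Q. set_dist {x} E < r} \<in> sets borel" "{x \<in> Q. r \<le> set_dist {x} E} \<in> sets borel"
proof -
  note [measurable] = point_dist_measurable[OF E_nonempty] is_cube_borel[OF assms]
  have "{x \<in> Q. set_dist {x} E < r} = Q \<inter> {x \<in> space borel. set_dist {x} E < r}"
    "{x \<in> Q. r \<le> set_dist {x} E} = Q \<inter> {x \<in> space borel. r \<le> set_dist {x} E}" by auto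
  moreover have "Q \<inter> {x \<in> space borel. set_dist {x} E < r} \<in> sets borel"
    "Q \<inter> {x \<in> space borel. r \<le> set_dist {x} E} \<in> sets borel"
    by measurable
  ultimately show "{x \<in> Q. set_dist {x} E < r} \<in> sets borel" "{x \<in> Q. r \<le> set_dist {x} E} \<in> sets borel"
    by simp_all
qed

lemma deep_borel: "is_cube Q \<Longrightarrow> deep Q \<in> sets borel"
  unfolding deep_def by (rule level_sets_borel)

lemma deep_measure:
  assumes "R \<in> \<D>"
  shows "ennreal (\<kappa> * side R ^ CARD('n)) \<le> emeasure lborel (deep R)"
proof -
  obtain M where M: "M \<in> \<D>" "M \<subseteq> R" "M \<inter> E = {}" "measure lborel R \<le> \<eta> * measure lborel M"
    using free_subcube[OF assms] by blast
  obtain b m where m: "0 < m" "M = cube b m" "side M = m" using cube_mem[OF M(1)] by (rule is_cubeE)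
  \<comment> \<open>\<open>N\<close> is the concentric cube of half the side, at distance
    \<open>m / 4\<close> from the faces of \<open>M\<close>.\<close>
  define N where "N = cube (\<chi> i. b $ i + m / 4) (m / 2)"
  have vol: "side R ^ CARD('n) \<le> \<eta> * m ^ CARD('n)"
    using M(4) m cube_mem[OF assms] cube_mem[OF M(1)] by (simp add: is_cube_measure)
  \<comment> \<open>Taking the \<open>d\<close>-th root of \<open>vol\<close> would give the factor
    \<open>\<eta>\<close> to the power \<open>1 / d\<close>; since \<open>\<eta> > 1\<close>, the
    cruder factor \<open>\<eta>\<close> is valid too.\<close>
  have side_le: "side R \<le> \<eta> * m"
  proof (rule ccontr)
    assume "\<not> ?thesis"
    then have "(\<eta> * m) ^ CARD('n) < side R ^ CARD('n)"
      using \<eta> m by (intro power_strict_mono) auto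
    moreover have "\<eta> * m ^ CARD('n) \<le> (\<eta> * m) ^ CARD('n)"
      using \<eta> m self_le_power[of \<eta> "CARD('n)"]
      by (auto simp: power_mult_distrib intro!: mult_right_mono)
    ultimately show False using vol by simp
  qed
  have "N \<subseteq> deep R"
  proof
    fix x assume "x \<in> N"
    then have x: "b $ i + m / 4 \<le> x $ i" "x $ i < b $ i + m / 4 + m / 2" for i
      by (auto simp: N_def cube_def)
    have "b $ i \<le> x $ i \<and> x $ i < b $ i + m" for i using x[of i] m(1) by linarith
    then have "x \<in> M" by (simp add: m(2) cube_def)
    have "m / 4 \<le> set_dist {x} E"
    proof (rule set_dist_greatest)
      fix y z assume "y \<in> {x}" "z \<in> E"
      then have "z \<notin> M" "y = x" using M(3) by auto
      \<comment> \<open>A point outside \<open>M\<close> leaves it in some coordinate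
        \<open>i\<close>, and this coordinate alone separates it from \<open>N\<close> by at least
        \<open>m / 4\<close>.\<close>
      then obtain i where "z $ i < b $ i \<or> b $ i + m \<le> z $ i"
        unfolding m(2) cube_def by (auto simp: not_le not_less)
      then have "m / 4 \<le> \<bar>(y - z) $ i\<bar>" using x[of i] m(1) \<open>y = x\<close> by (auto simp: abs_if)
      also have "\<dots> \<le> infnorm (y - z)" by (rule component_le_infnorm_cart)
      finally show "m / 4 \<le> infnorm (y - z)" .
    qed (use E_nonempty in auto)
    moreover have "side R / (4 * \<eta>) \<le> m / 4" using side_le \<eta> by (simp add: field_simps)
    ultimately show "x \<in> deep R" using \<open>x \<in> M\<close> M(2) by (auto simp: deep_def)
  qed
  have "\<kappa> * side R ^ CARD('n) \<le> \<kappa> * (\<eta> * m ^ CARD('n))"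
    using vol \<kappa> by (intro mult_left_mono) auto
  also have "\<dots> = (m / 2) ^ CARD('n)" using \<eta> by (simp add: \<kappa>_def power_divide)
  finally have "ennreal (\<kappa> * side R ^ CARD('n)) \<le> ennreal ((m / 2) ^ CARD('n))" by (rule ennreal_leI)
  also have "\<dots> = emeasure lborel N" using m(1) by (simp add: N_def emeasure_cube)
  also have "\<dots> \<le> emeasure lborel (deep R)"
    using \<open>N \<subseteq> deep R\<close> deep_borel[OF cube_mem[OF assms]] by (intro emeasure_mono) auto
  finally show ?thesis .
qed

lemma shallow_measure:
  assumes "R \<in> \<D>"
  shows "emeasure lborel {x \<in> R. set_dist {x} E < side R / (4 * \<eta>)}
    \<le> ennreal ((1 - \<kappa>) * side R ^ CARD('n))" (is "emeasure lborel ?S \<le> _")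
proof -
  have R: "is_cube R" using assms by (rule cube_mem)
  have "emeasure lborel (deep R) + emeasure lborel ?S = emeasure lborel (deep R \<union> ?S)"
    using deep_borel[OF R] level_sets_borel[OF R] by (intro plus_emeasure) (auto simp: deep_def)
  also have "deep R \<union> ?S = R" by (auto simp: deep_def)
  finally have eq: "emeasure lborel (deep R) + emeasure lborel ?S = ennreal (side R ^ CARD('n))"
    using R by (simp add: is_cube_emeasure)
  \<comment> \<open>Both measures are finite, so the subtraction can be carried out in the
    reals.\<close>
  have "emeasure lborel (deep R) \<noteq> top" "emeasure lborel ?S \<noteq> top" using eq by auto
  then obtain u v where u: "0 \<le> u" "emeasure lborel (deep R) = ennreal u"
    and v: "0 \<le> v" "emeasure lborel ?S = ennreal v"
    by (cases "emeasure lborel (deep R)"; cases "emeasure lborel ?S") auto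
  have "u + v = side R ^ CARD('n)" using eq u v side_pos[OF R] by (simp flip: ennreal_plus)
  moreover have "\<kappa> * side R ^ CARD('n) \<le> u" using deep_measure[OF assms] u by simp
  ultimately show ?thesis unfolding v by (intro ennreal_leI) (simp add: algebra_simps)
qed

text \<open>A cube of the \<open>k\<close>-th generation of \<open>R\<close> containing a point at distance less than its side from
  \<open>E\<close> is contained in the shallow part of \<open>R\<close>, so each \<open>k\<close> generations cost a factor \<open>1 - \<kappa>\<close>.\<close>

lemma neighbourhood_measure:
  assumes k: "2 / 2 ^ k \<le> 1 / (4 * \<eta>)" and "R \<in> \<D>"
  shows "emeasure lborel {x \<in> R. set_dist {x} E < side R / 2 ^ (j * k)}
    \<le> ennreal ((1 - \<kappa>) ^ j * side R ^ CARD('n))"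
  using assms(2)
proof (induction j arbitrary: R)
  case 0
  then have R: "is_cube R" by (intro cube_mem)
  have "emeasure lborel {x \<in> R. set_dist {x} E < side R / 2 ^ (0 * k)} \<le> emeasure lborel R"
    using R by (intro emeasure_mono) (auto simp: is_cube_borel)
  then show ?case using R by (simp add: is_cube_emeasure)
next
  case (Suc j)
  have R: "is_cube R" using Suc.prems by (rule cube_mem)
  define V where "V Q = {x \<in> Q. set_dist {x} E < side Q / 2 ^ (j * k)}" for Q
  define Bad where "Bad = {Q \<in> subcubes k R. \<exists>x\<in>Q. set_dist {x} E < side Q}"
  define S where "S = {x \<in> R. set_dist {x} E < side R / (4 * \<eta>)}"
  have Bad: "finite Bad" "\<And>Q. Q \<in> Bad \<Longrightarrow> Q \<in> \<D> \<and> is_cube Q"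
    using finite_subcubes[OF R] subcubes_mem[OF Suc.prems] cube_mem by (auto simp: Bad_def)
  have "{x \<in> R. set_dist {x} E < side R / 2 ^ (Suc j * k)} \<subseteq> (\<Union>Q\<in>Bad. V Q)"
  proof
    fix x assume x: "x \<in> {x \<in> R. set_dist {x} E < side R / 2 ^ (Suc j * k)}"
    then obtain Q where Q: "x \<in> Q" "Q \<in> subcubes k R" using is_cube_Union_subcubes[OF R, of k] by blast
    have "side Q = side R / 2 ^ k" "0 < side Q"
      using subcubes_props(2)[OF R Q(2)] side_pos[OF subcubes_props(1)[OF R Q(2)]] by blast+
    \<comment> \<open>After \<open>k\<close> generations the radius becomes exactly the one in the
      induction hypothesis for \<open>Q\<close>.\<close>
    then have "side R / 2 ^ (Suc j * k) = side Q / 2 ^ (j * k)" by (simp add: power_add)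
    then have lt: "set_dist {x} E < side Q / 2 ^ (j * k)" using x by simp
    also have "\<dots> \<le> side Q" using \<open>0 < side Q\<close> by (simp add: field_simps)
    finally show "x \<in> (\<Union>Q\<in>Bad. V Q)" using Q lt by (auto simp: V_def Bad_def)
  qed
  then have "emeasure lborel {x \<in> R. set_dist {x} E < side R / 2 ^ (Suc j * k)}
      \<le> emeasure lborel (\<Union>Q\<in>Bad. V Q)"
    using Bad level_sets_borel by (intro emeasure_mono) (auto simp: V_def)
  also have "\<dots> \<le> (\<Sum>Q\<in>Bad. emeasure lborel (V Q))"
    using Bad level_sets_borel by (intro emeasure_subadditive_finite) (auto simp: V_def)
  \<comment> \<open>The induction hypothesis in each bad cube gives
    \<open>(1 - \<kappa>) ^ j\<close>; the last factor \<open>1 - \<kappa>\<close> will come from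
    the total volume of the bad cubes.\<close>
  also have "\<dots> \<le> (\<Sum>Q\<in>Bad. ennreal ((1 - \<kappa>) ^ j) * emeasure lborel Q)"
    using Suc.IH Bad \<kappa> by (intro sum_mono) (simp add: V_def is_cube_emeasure ennreal_mult')
  also have "\<dots> = ennreal ((1 - \<kappa>) ^ j) * (\<Sum>Q\<in>Bad. emeasure lborel Q)"
    by (simp add: sum_distrib_left)
  also have "(\<Sum>Q\<in>Bad. emeasure lborel Q) = emeasure lborel (\<Union>Q\<in>Bad. Q)"
  proof (rule sum_emeasure)
    show "disjoint_family_on (\<lambda>Q. Q) Bad"
      using is_cube_disjoint_subcubes[OF R, of k] by (auto simp: disjoint_family_on_def disjoint_def Bad_def)
  qed (use Bad is_cube_borel in auto)
  also have "emeasure lborel (\<Union>Q\<in>Bad. Q) \<le> emeasure lborel S"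
  proof (rule emeasure_mono)
    show "(\<Union>Q\<in>Bad. Q) \<subseteq> S"
    proof clarify
      fix y Q assume "Q \<in> Bad" "y \<in> Q"
      then obtain x where x: "x \<in> Q" "set_dist {x} E < side Q" and Q: "Q \<in> subcubes k R"
        by (auto simp: Bad_def)
      have sQ: "is_cube Q" "side Q = side R / 2 ^ k" "Q \<subseteq> R" using subcubes_props[OF R Q] by auto
      have "set_dist {y} E \<le> side Q + set_dist {x} E"
        using x(1) \<open>y \<in> Q\<close> sQ(1) E_nonempty by (intro set_dist_triangle) (auto simp: is_cube_infnorm)
      also have "\<dots> < (2 / 2 ^ k) * side R" using x(2) sQ(2) by simp
      \<comment> \<open>Here the choice of \<open>k\<close> enters: two sides of a bad cube fit
        below the shallow threshold of \<open>R\<close>.\<close>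
      also have "\<dots> \<le> (1 / (4 * \<eta>)) * side R"
        using k side_pos[OF R] by (intro mult_right_mono) auto
      finally show "y \<in> S" using \<open>y \<in> Q\<close> sQ(3) by (auto simp: S_def)
    qed
    show "S \<in> sets lborel" using level_sets_borel[OF R] by (simp add: S_def)
  qed
  also have "emeasure lborel S \<le> ennreal ((1 - \<kappa>) * side R ^ CARD('n))"
    using Suc.prems unfolding S_def by (rule shallow_measure)
  also have "ennreal ((1 - \<kappa>) ^ j) * ennreal ((1 - \<kappa>) * side R ^ CARD('n))
      = ennreal ((1 - \<kappa>) ^ Suc j * side R ^ CARD('n))"
    using \<kappa> by (simp add: mult_ac flip: ennreal_mult')
  finally show ?case by (simp add: mult_left_mono)
qed

section \<open>The points at distance zero from \<open>E\<close>, and the weighted measure of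
  cubes\<close>

lemma generation_exists: "\<exists>k>0. 2 / 2 ^ k \<le> 1 / (4 * \<eta>)"
proof -
  have "0 < 1 / (8 * \<eta>)" using \<eta> by simp
  then obtain k where k: "(1 / 2) ^ k < 1 / (8 * \<eta>)"
    using real_arch_pow_inv[of "1 / (8 * \<eta>)" "1 / 2 :: real"] by auto
  have "k \<noteq> 0" using k \<eta> by (intro notI) (simp add: field_simps)
  moreover have "2 / 2 ^ k \<le> 1 / (4 * \<eta>)" using k \<eta> by (simp add: field_simps)
  ultimately show ?thesis by blast
qed

text \<open>The zero set lies in every neighbourhood, and the bounds
  \<open>(1 - \<kappa>) ^ j * side R ^ d\<close> tend to zero.\<close>

lemma null_in_cube:
  assumes "R \<in> \<D>"
  shows "{x \<in> R. set_dist {x} E = 0} \<in> null_sets lborel"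
proof -
  have R: "is_cube R" using assms by (rule cube_mem)
  obtain k where k: "2 / 2 ^ k \<le> 1 / (4 * \<eta>)" using generation_exists by blast
  let ?Z = "{x \<in> R. set_dist {x} E = 0}"
  note [measurable] = point_dist_measurable[OF E_nonempty] is_cube_borel[OF R]
  have "R \<inter> {x \<in> space borel. set_dist {x} E = 0} \<in> sets borel" by measurable
  then have Z: "?Z \<in> sets borel" by (simp add: Int_def)
  have "emeasure lborel ?Z \<le> ennreal ((1 - \<kappa>) ^ j * side R ^ CARD('n))" for j
  proof -
    have "emeasure lborel ?Z \<le> emeasure lborel {x \<in> R. set_dist {x} E < side R / 2 ^ (j * k)}"
      using level_sets_borel[OF R] side_pos[OF R] by (intro emeasure_mono) auto
    also have "\<dots> \<le> ennreal ((1 - \<kappa>) ^ j * side R ^ CARD('n))"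
      by (rule neighbourhood_measure[OF k assms])
    finally show ?thesis .
  qed
  moreover have "(\<lambda>j. ennreal ((1 - \<kappa>) ^ j * side R ^ CARD('n))) \<longlonglongrightarrow> ennreal (0 * side R ^ CARD('n))"
    using \<kappa> by (intro tendsto_ennrealI tendsto_mult LIMSEQ_realpow_zero tendsto_const) auto
  ultimately have "emeasure lborel ?Z \<le> 0"
    by (intro LIMSEQ_le_const) auto
  then show ?thesis using Z by auto
qed

text \<open>By (DL3) countably many lattice cubes, one around each ball of integer radius, cover the
  space.\<close>

lemma null_E: "{x. set_dist {x} E = 0} \<in> null_sets lborel"
proof -
  have "\<exists>Q\<in>\<D>. cball 0 (real n) \<subseteq> Q" for n by (rule compact_covered) simp
  then obtain Q where Q: "\<And>n. Q n \<in> \<D>" "\<And>n. cball 0 (real n) \<subseteq> Q n" by metis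
  have "{x. set_dist {x} E = 0} = (\<Union>n. {x \<in> Q n. set_dist {x} E = 0})"
  proof (intro equalityI subsetI)
    fix x assume x: "x \<in> {x. set_dist {x} E = 0}"
    obtain n where "norm x \<le> real n" using real_arch_simple by blast
    then have "x \<in> Q n" using Q(2)[of n] by auto
    then show "x \<in> (\<Union>n. {x \<in> Q n. set_dist {x} E = 0})" using x by auto
  qed auto
  then show ?thesis using null_in_cube[OF Q(1)] by (simp add: null_sets_UN)
qed

lemma closure_null: "emeasure lborel (closure E) = 0"
proof -
  have "closure E \<subseteq> {x. set_dist {x} E = 0}" by (auto simp: point_dist_closure)
  then have "emeasure lborel (closure E) \<le> emeasure lborel {x. set_dist {x} E = 0}"
    using null_E by (intro emeasure_mono) auto
  then show ?thesis using null_E by (simp add: null_setsD1)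
qed

text \<open>A pointwise layer decomposition. If \<open>j\<close> is the last level with distance
  below \<open>l / 2 ^ (j * k)\<close>, the distance is at least the radius of level
  \<open>Suc j\<close>, so the \<open>j\<close>-th term alone dominates the density. This is why its
  weight carries the exponent \<open>Suc j\<close>.\<close>

lemma dist_dens_le_levels:
  assumes l: "0 < l" and "0 < \<alpha>" "0 < k" and pos: "0 < set_dist {x} E"
  shows "dist_dens \<alpha> E x \<le> ennreal (l powr - \<alpha>) +
    (\<Sum>j. ennreal (l powr - \<alpha> * (2 powr (real k * \<alpha>)) ^ Suc j) *
      indicator {x. set_dist {x} E < l / 2 ^ (j * k)} x)" (is "_ \<le> _ + (\<Sum>j. ?f j)")
proof (cases "l \<le> set_dist {x} E")
  case True
  then have "dist_dens \<alpha> E x \<le> ennreal (l powr - \<alpha>)" using assms by (intro dist_dens_le)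
  then show ?thesis by (simp add: add_increasing2)
next
  case False
  define P where "P n \<longleftrightarrow> l / 2 ^ (n * k) \<le> set_dist {x} E" for n
  obtain n where n: "(1 / 2) ^ n < set_dist {x} E / l"
    using real_arch_pow_inv[of "set_dist {x} E / l" "1 / 2 :: real"] pos l by auto
  have "l / 2 ^ (n * k) \<le> l / 2 ^ n"
    using l \<open>0 < k\<close> by (intro divide_left_mono power_increasing) auto
  also have "\<dots> \<le> set_dist {x} E" using n l by (simp add: field_simps)
  finally have "P n" by (simp add: P_def)
  moreover have "\<not> P 0" using False by (simp add: P_def)
  \<comment> \<open>Level \<open>0\<close> fails \<open>P\<close> and level \<open>n\<close>
    satisfies it, so there is a switch between two consecutive levels.\<close>
  ultimately obtain j where j: "\<not> P j" "P (Suc j)"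
    using ex_least_nat_less[of P n] by auto
  have "dist_dens \<alpha> E x \<le> ennreal ((l / 2 ^ (Suc j * k)) powr - \<alpha>)"
    using j(2) assms by (intro dist_dens_le) (auto simp: P_def)
  also have "(l / 2 ^ (Suc j * k)) powr - \<alpha> = l powr - \<alpha> * (2 powr (real k * \<alpha>)) ^ Suc j"
  proof -
    have "(2::real) ^ (Suc j * k) = 2 powr real (Suc j * k)" by (rule powr_realpow[symmetric]) simp
    moreover have "(2 powr (real k * \<alpha>)) ^ Suc j = 2 powr (real (Suc j * k) * \<alpha>)"
      by (simp add: powr_powr algebra_simps powr_add flip: powr_realpow)
    ultimately show ?thesis using l by (simp add: powr_divide powr_powr powr_minus field_simps)
  qed
  also have "ennreal (l powr - \<alpha> * (2 powr (real k * \<alpha>)) ^ Suc j) = ?f j"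
    using j(1) by (simp add: P_def)
  also have "\<dots> \<le> (\<Sum>j. ?f j)" by (rule ennreal_term_le_suminf)
  finally show ?thesis by (simp add: add_increasing)
qed

text \<open>Integrating the layers gives a geometric series: the neighbourhoods shrink like
  \<open>(1 - \<kappa>) ^ j\<close> while the weights grow like powers of
  \<open>2 powr (real k * \<alpha>)\<close>. The hypothesis on the product makes the ratio less than
  one.\<close>

lemma dist_measure_le:
  assumes \<alpha>: "0 < \<alpha>" and k: "0 < k" "2 / 2 ^ k \<le> 1 / (4 * \<eta>)"
    and q: "(1 - \<kappa>) * 2 powr (real k * \<alpha>) < 1" and "R \<in> \<D>"
  shows "emeasure (dist_measure \<alpha> E) R
    \<le> ennreal ((1 + 2 powr (real k * \<alpha>) / (1 - (1 - \<kappa>) * 2 powr (real k * \<alpha>)))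
        * side R powr (real CARD('n) - \<alpha>))"
proof -
  define l where "l = side R"
  define p where "p = 2 powr (real k * \<alpha>)"
  define V where "V j = {x \<in> R. set_dist {x} E < l / 2 ^ (j * k)}" for j
  define c where "c j = l powr - \<alpha> * p ^ Suc j" for j
  have R: "is_cube R" using \<open>R \<in> \<D>\<close> by (rule cube_mem)
  have l: "0 < l" using side_pos[OF R] by (simp add: l_def)
  have p: "0 < p" by (simp add: p_def)
  have q: "(1 - \<kappa>) * p < 1" "0 < (1 - \<kappa>) * p" using q \<kappa> p by (auto simp: p_def)
  have V [measurable]: "V j \<in> sets borel" for j unfolding V_def by (rule level_sets_borel[OF R])
  have [measurable]: "R \<in> sets borel" by (rule is_cube_borel[OF R])
  have "emeasure (dist_measure \<alpha> E) R = (\<integral>\<^sup>+ x. dist_dens \<alpha> E x * indicator R x \<partial>lborel)"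
    using E_nonempty by (rule emeasure_dist_measure) measurable
  also have "\<dots> \<le> (\<integral>\<^sup>+ x. ennreal (l powr - \<alpha>) * indicator R x +
      (\<Sum>j. ennreal (c j) * indicator (V j) x) \<partial>lborel)"
  proof (rule nn_integral_mono_AE)
    \<comment> \<open>The layer bound concerns positive distance only; the remaining points form a
      null set.\<close>
    have "AE x in lborel. x \<notin> {x. set_dist {x} E = 0}" using null_E by (rule AE_not_in)
    then show "AE x in lborel. dist_dens \<alpha> E x * indicator R x \<le> ennreal (l powr - \<alpha>) * indicator R x +
      (\<Sum>j. ennreal (c j) * indicator (V j) x)"
    proof eventually_elim
      case (elim x)
      have "0 < set_dist {x} E" using elim set_dist_nonneg[of "{x}" E] E_nonempty by simp
      then show ?case
        using dist_dens_le_levels[OF l \<alpha> k(1), of x]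
        by (cases "x \<in> R") (auto simp: V_def c_def p_def indicator_def)
    qed
  qed
  also have "\<dots> = ennreal (l powr - \<alpha>) * emeasure lborel R + (\<Sum>j. ennreal (c j) * emeasure lborel (V j))"
    by (subst nn_integral_add) (auto simp: nn_integral_suminf nn_integral_cmult_indicator)
  also have "\<dots> \<le> ennreal (l powr - \<alpha>) * ennreal (l ^ CARD('n)) +
      (\<Sum>j. ennreal (l powr - \<alpha> * l ^ CARD('n) * p * ((1 - \<kappa>) * p) ^ j))"
  proof (intro add_mono suminf_le)
    fix j
    have "ennreal (c j) * emeasure lborel (V j) \<le> ennreal (c j) * ennreal ((1 - \<kappa>) ^ j * l ^ CARD('n))"
      using neighbourhood_measure[OF k(2) \<open>R \<in> \<D>\<close>, of j] by (intro mult_left_mono) (auto simp: V_def l_def)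
    also have "\<dots> = ennreal (l powr - \<alpha> * l ^ CARD('n) * p * ((1 - \<kappa>) * p) ^ j)"
      using p by (simp add: c_def power_mult_distrib mult_ac flip: ennreal_mult')
    finally show "ennreal (c j) * emeasure lborel (V j)
      \<le> ennreal (l powr - \<alpha> * l ^ CARD('n) * p * ((1 - \<kappa>) * p) ^ j)" .
  qed (auto simp: is_cube_emeasure[OF R] l_def)
  also have "(\<Sum>j. ennreal (l powr - \<alpha> * l ^ CARD('n) * p * ((1 - \<kappa>) * p) ^ j))
      = ennreal (l powr - \<alpha> * l ^ CARD('n) * p * (1 / (1 - (1 - \<kappa>) * p)))"
    using q p l by (intro suminf_ennreal_eq sums_mult geometric_sums) (auto simp: less_imp_le)
  also have "ennreal (l powr - \<alpha>) * ennreal (l ^ CARD('n)) + \<dots>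
      = ennreal ((1 + p / (1 - (1 - \<kappa>) * p)) * (l powr - \<alpha> * l ^ CARD('n)))"
    using q p l by (subst ennreal_mult[symmetric], simp, simp, subst ennreal_plus[symmetric])
      (auto simp: less_imp_le algebra_simps)
  also have "l powr - \<alpha> * l ^ CARD('n) = l powr (real CARD('n) - \<alpha>)"
    using l by (simp add: powr_diff powr_minus powr_realpow field_simps)
  finally show ?thesis by (simp add: p_def l_def)
qed

lemma dist_measure_cubes:
  obtains \<alpha> C where "0 < \<alpha>" "0 < C"
    "\<And>R. R \<in> \<D> \<Longrightarrow> emeasure (dist_measure \<alpha> E) R \<le> ennreal (C * side R powr (real CARD('n) - \<alpha>))"
proof -
  obtain k where k: "0 < k" "2 / 2 ^ k \<le> 1 / (4 * \<eta>)" using generation_exists by blast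
  \<comment> \<open>The exponent \<open>\<alpha>\<close> is chosen so that
    \<open>2 powr (real k * \<alpha>) = q\<close>: then \<open>q > 1\<close> makes
    \<open>\<alpha>\<close> positive, and \<open>q < 1 / (1 - \<kappa>)\<close> makes the series
    converge.\<close>
  have "1 < 1 / (1 - \<kappa>)" using \<kappa> by simp
  then obtain q where q: "1 < q" "q < 1 / (1 - \<kappa>)" using dense by blast
  define \<alpha> where "\<alpha> = log 2 q / real k"
  have \<alpha>: "0 < \<alpha>" using q k by (simp add: \<alpha>_def)
  have p: "2 powr (real k * \<alpha>) = q" using q k by (simp add: \<alpha>_def)
  have lt: "(1 - \<kappa>) * q < 1" using q \<kappa> by (simp add: field_simps)
  show thesis
    using that[OF \<alpha>, of "1 + q / (1 - (1 - \<kappa>) * q)"] dist_measure_le[OF \<alpha> k] lt q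
    by (simp add: p add_pos_nonneg)
qed

text \<open>Every point of a near cube is within \<open>(1 + \<gamma>) * side Q\<close> of
  \<open>E\<close>, which bounds the density below, and the deep part has at least the proportion
  \<open>\<kappa>\<close> of the volume.\<close>

lemma dist_measure_deep:
  assumes "0 < \<alpha>" "0 < \<gamma>" "Q \<in> near_cubes \<D> \<gamma> E"
  shows "ennreal (\<kappa> * (1 + \<gamma>) powr - \<alpha> * side Q powr (real CARD('n) - \<alpha>))
    \<le> emeasure (dist_measure \<alpha> E) (deep Q)"
proof -
  have Q: "Q \<in> \<D>" "is_cube Q" "set_dist Q E < \<gamma> * side Q"
    using assms cube_mem by (auto simp: near_cubes_def)
  have s: "0 < side Q" using side_pos[OF Q(2)] .
  have [measurable]: "deep Q \<in> sets borel" using Q(2) by (rule deep_borel)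
  define r where "r = ((1 + \<gamma>) * side Q) powr - \<alpha>"
  have "\<kappa> * (1 + \<gamma>) powr - \<alpha> * side Q powr (real CARD('n) - \<alpha>) = r * (\<kappa> * side Q ^ CARD('n))"
    using s assms unfolding r_def by (simp add: powr_mult powr_diff powr_realpow powr_minus divide_simps)
  then have "ennreal (\<kappa> * (1 + \<gamma>) powr - \<alpha> * side Q powr (real CARD('n) - \<alpha>))
      = ennreal (r * (\<kappa> * side Q ^ CARD('n)))"
    by (rule arg_cong)
  also have "\<dots> = ennreal r * ennreal (\<kappa> * side Q ^ CARD('n))"
    by (rule ennreal_mult') (simp add: r_def)
  also have "\<dots> \<le> ennreal r * emeasure lborel (deep Q)"
    using deep_measure[OF Q(1)] by (rule mult_left_mono) simp
  also have "\<dots> = (\<integral>\<^sup>+ x. ennreal r * indicator (deep Q) x \<partial>lborel)"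
    by (simp add: nn_integral_cmult_indicator)
  also have "\<dots> \<le> (\<integral>\<^sup>+ x. dist_dens \<alpha> E x * indicator (deep Q) x \<partial>lborel)"
  proof (rule nn_integral_mono)
    fix x
    have "ennreal r \<le> dist_dens \<alpha> E x" if "x \<in> deep Q"
    proof -
    have "set_dist {x} E \<le> side Q + set_dist Q E"
      using that Q(2) E_nonempty by (intro set_dist_point_le_cube) (auto simp: deep_def)
    also have "\<dots> \<le> (1 + \<gamma>) * side Q" using Q(3) by (simp add: algebra_simps)
    finally show ?thesis
      unfolding r_def using assms s E_nonempty by (intro dist_dens_ge) auto
    qed
    then show "ennreal r * indicator (deep Q) x \<le> dist_dens \<alpha> E x * indicator (deep Q) x"
      by (simp add: indicator_def)
  qed
  also have "\<dots> = emeasure (dist_measure \<alpha> E) (deep Q)"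
    using E_nonempty by (subst emeasure_dist_measure) auto
  finally show ?thesis .
qed

text \<open>The cubes whose deep parts contain \<open>x\<close> are nested. Depth in the largest,
  \<open>P\<close>, keeps \<open>x\<close> at least \<open>side P / (4 * \<eta>)\<close> from
  \<open>E\<close>; nearness of any other \<open>Q\<close> puts \<open>x\<close> within
  \<open>(1 + \<gamma>) * side Q\<close>. So the sides differ by less than the factor
  \<open>2 ^ m\<close>, leaving only \<open>m\<close> generations, with one cube in each at
  most.\<close>

lemma deep_overlap:
  assumes "0 < \<gamma>" "4 * \<eta> * (1 + \<gamma>) < 2 ^ m" "R \<in> \<D>" "F \<subseteq> near_cubes_in \<D> \<gamma> E R"
  shows "finite {Q \<in> F. x \<in> deep Q} \<and> card {Q \<in> F. x \<in> deep Q} \<le> m"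
proof (cases "{Q \<in> F. x \<in> deep Q} = {}")
  case False
  define S where "S = {Q \<in> F. x \<in> deep Q}"
  have S: "Q \<in> \<D>" "is_cube Q" "set_dist Q E < \<gamma> * side Q" "x \<in> Q" "Q \<subseteq> R" if "Q \<in> S" for Q
    using that assms cube_mem by (auto simp: S_def near_cubes_in_def near_cubes_def deep_def)
  have "\<exists>j. Q \<in> subcubes j R" if "Q \<in> S" for Q
    using subset_level[OF S(1)[OF that] \<open>R \<in> \<D>\<close> S(5)[OF that]] by blast
  then obtain lev where lev: "\<And>Q. Q \<in> S \<Longrightarrow> Q \<in> subcubes (lev Q) R" by metis
  have side: "side Q = side R / 2 ^ lev Q" if "Q \<in> S" for Q
    using subcubes_props(2)[OF cube_mem[OF \<open>R \<in> \<D>\<close>] lev[OF that]] .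
  have inj: "inj_on lev S"
  proof (rule inj_onI)
    fix P Q assume "P \<in> S" "Q \<in> S" "lev P = lev Q"
    then show "P = Q" by (intro eq_of_side[of P Q x] S) (auto simp: side)
  qed
  \<comment> \<open>Least generation means largest side.\<close>
  obtain P where P: "P \<in> S" "\<And>Q. Q \<in> S \<Longrightarrow> lev P \<le> lev Q"
    using False ex_has_least_nat[of "\<lambda>Q. Q \<in> S" _ lev] unfolding S_def[symmetric] by blast
  have R: "0 < side R" using side_pos[OF cube_mem[OF \<open>R \<in> \<D>\<close>]] .
  have "lev Q < lev P + m" if Q: "Q \<in> S" for Q
  proof -
    have "side P / (4 * \<eta>) \<le> set_dist {x} E" using P(1) by (simp add: S_def deep_def)
    also have "\<dots> \<le> side Q + set_dist Q E"
      using S[OF Q] E_nonempty by (intro set_dist_point_le_cube)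
    also have "\<dots> < (1 + \<gamma>) * side Q" using S(3)[OF Q] by (simp add: algebra_simps)
    finally have "side P < 4 * \<eta> * (1 + \<gamma>) * side Q" using \<eta> by (simp add: field_simps)
    also have "\<dots> < 2 ^ m * side Q"
      using assms(2) side_pos[OF S(2)[OF Q]] by (rule mult_strict_right_mono)
    finally have "side R / 2 ^ lev P < 2 ^ m * (side R / 2 ^ lev Q)" by (simp add: side P Q)
    then have "(2::real) ^ lev Q < 2 ^ (lev P + m)" using R by (simp add: field_simps power_add)
    then show ?thesis by simp
  qed
  then have sub: "lev ` S \<subseteq> {lev P..<lev P + m}" using P(2) by auto
  have "finite S" using inj sub finite_subset finite_imageD by blast
  moreover have "card S \<le> m" using card_inj_on_le[OF inj sub] by simp
  ultimately show ?thesis by (simp add: S_def)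
next
  case True
  then show ?thesis by (simp only: finite.emptyI card.empty zero_le simp_thms)
qed

end

section \<open>Powers on the extended half-line\<close>

lemma enn_powr_ennreal: "0 \<le> r \<Longrightarrow> enn_powr (ennreal r) p = ennreal (r powr p)"
  by (simp add: enn_powr_def)

lemma enn_powr_top [simp]: "enn_powr top p = top"
  by (simp add: enn_powr_def)

lemma enn_powr_mono:
  assumes "x \<le> y" "0 \<le> p"
  shows "enn_powr x p \<le> enn_powr y p"
proof (cases y)
  case (real s)
  then obtain r where "x = ennreal r" "0 \<le> r" using assms by (cases x) (auto simp: top_unique)
  then show ?thesis using assms real by (simp add: enn_powr_ennreal ennreal_leI powr_mono2)
qed simp

lemma enn_powr_one [simp]: "enn_powr x 1 = x"
  by (cases x) (auto simp: enn_powr_ennreal)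

lemma enn_powr_inverse: "0 < p \<Longrightarrow> enn_powr (enn_powr x p) (1 / p) = x"
  by (cases x) (auto simp: enn_powr_ennreal powr_powr)

lemma enn_powr_mult:
  assumes "0 < c"
  shows "enn_powr (ennreal c * x) p = ennreal (c powr p) * enn_powr x p"
proof (cases x)
  case (real r)
  then show ?thesis
    using assms by (simp add: enn_powr_ennreal powr_mult flip: ennreal_mult)
next
  case top
  then show ?thesis using assms by (simp add: ennreal_mult_top)
qed

text \<open>Taking \<open>1 / p\<close>-th powers reduces the claim to monotonicity: each
  \<open>f n\<close> lies below that power of the right side.\<close>

lemma enn_powr_SUP_le:
  assumes "0 < p"
  shows "enn_powr (SUP n. f n) p \<le> (SUP n. enn_powr (f n) p)"
proof -
  let ?y = "SUP n. enn_powr (f n) p"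
  have "f n \<le> enn_powr ?y (1 / p)" for n
  proof -
    have "f n = enn_powr (enn_powr (f n) p) (1 / p)" using assms by (simp add: enn_powr_inverse)
    also have "\<dots> \<le> enn_powr ?y (1 / p)" using assms by (intro enn_powr_mono SUP_upper) auto
    finally show ?thesis .
  qed
  then have "enn_powr (SUP n. f n) p \<le> enn_powr (enn_powr ?y (1 / p)) p"
    using assms by (intro enn_powr_mono SUP_least) auto
  also have "\<dots> = ?y" using enn_powr_inverse[of "1 / p" ?y] assms by simp
  finally show ?thesis .
qed

lemma enn_powr_measurable [measurable]:
  assumes [measurable]: "f \<in> borel_measurable M"
  shows "(\<lambda>x. enn_powr (f x) p) \<in> borel_measurable M"
  unfolding enn_powr_def by measurable

section \<open>Sparse families\<close>

lemma powr_diff_le: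
  fixes u t p :: real
  assumes "0 \<le> u" "u \<le> t" "1 \<le> p"
  shows "t powr p \<le> u powr p + p * (t - u) * t powr (p - 1)"
proof -
  \<comment> \<open>For \<open>0 < u < t\<close> the mean value theorem applies. The case
    \<open>u = 0\<close> is separate, since the derivative rule for \<open>powr\<close> needs a
    positive base.\<close>
  consider "u = t" | "u = 0" "0 < t" | "0 < u" "u < t" using assms by linarith
  then show ?thesis
  proof cases
    case 2
    then have "t powr p = t * t powr (p - 1)" by (simp add: powr_mult_base)
    also have "\<dots> \<le> p * (t * t powr (p - 1))"
      using mult_right_mono[of 1 p "t * t powr (p - 1)"] assms 2 by simp
    finally show ?thesis using 2 by (simp add: mult_ac)
  next
    case 3
    then obtain z where z: "u < z" "z < t" "t powr p - u powr p = (t - u) * (p * z powr (p - 1))"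
      using MVT2[of u t "\<lambda>x. x powr p" "\<lambda>z. p * z powr (p - 1)"]
      by (force intro: has_real_derivative_powr)
    have "z powr (p - 1) \<le> t powr (p - 1)" using z 3 assms by (intro powr_mono2) auto
    then have "(t - u) * (p * z powr (p - 1)) \<le> (t - u) * (p * t powr (p - 1))"
      using 3 assms by (intro mult_left_mono) auto
    then show ?thesis using z(3) by (simp add: mult_ac)
  qed simp
qed

text \<open>Compare \<open>t\<close> with \<open>2 * D * s\<close>. If \<open>t\<close> is at least
  as large, then \<open>D * s \<le> t / 2\<close> and the first term suffices; otherwise
  \<open>t\<close> is replaced by \<open>2 * D * s\<close> and the second term suffices.\<close>

lemma young_powr:
  fixes D s t p :: real
  assumes "0 \<le> D" "0 \<le> s" "0 \<le> t" "1 \<le> p"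
  shows "D * s * t powr (p - 1) \<le> t powr p / 2 + (2 * D) powr p * s powr p"
proof (cases "2 * D * s \<le> t")
  case True
  then have "D * s * t powr (p - 1) \<le> t / 2 * t powr (p - 1)"
    by (intro mult_right_mono) auto
  also have "\<dots> = t powr p / 2" using assms by (simp add: powr_mult_base)
  finally show ?thesis by (simp add: add_increasing2)
next
  case False
  then have "D * s * t powr (p - 1) \<le> (2 * D * s) * (2 * D * s) powr (p - 1)"
    using assms by (intro mult_mono powr_mono2) auto
  also have "\<dots> = (2 * D * s) powr p" using assms by (simp add: powr_mult_base)
  also have "\<dots> = (2 * D) powr p * s powr p" using assms by (simp add: powr_mult)
  finally show ?thesis by (simp add: add_increasing)
qed

text \<open>Discrete form of integrating the derivative of a power along the chain. Removing the
  smallest set \<open>Q\<close>, whose inner sum is the full sum, costs exactly the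
  \<open>Q\<close>-term by \<open>powr_diff_le\<close>.\<close>

lemma chain_sum_powr:
  fixes a :: "'a set \<Rightarrow> real"
  assumes "finite F" "1 \<le> p" "\<And>Q. Q \<in> F \<Longrightarrow> 0 \<le> a Q"
    and "\<And>P Q. P \<in> F \<Longrightarrow> Q \<in> F \<Longrightarrow> P \<subseteq> Q \<or> Q \<subseteq> P"
  shows "(\<Sum>Q\<in>F. a Q) powr p \<le> p * (\<Sum>Q\<in>F. a Q * (\<Sum>P | P \<in> F \<and> Q \<subseteq> P. a P) powr (p - 1))"
  using assms(1,3,4)
proof (induction F rule: finite_psubset_induct)
  case (psubset F)
  show ?case
  proof (cases "F = {}")
    case False
    obtain Q where Q: "Q \<in> F" "\<And>P. P \<in> F \<Longrightarrow> P \<subseteq> Q \<Longrightarrow> P = Q"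
      using finite_has_minimal[OF psubset.hyps False] by blast
    have below: "Q \<subseteq> P" if "P \<in> F" for P using Q that psubset.prems(2) by blast
    define F' where "F' = F - {Q}"
    have F: "F = insert Q F'" "Q \<notin> F'" "finite F'" using Q psubset.hyps by (auto simp: F'_def)
    define u where "u = sum a F'"
    have u: "0 \<le> u" unfolding u_def using psubset.prems F by (intro sum_nonneg) auto
    have sumF: "sum a F = a Q + u" using F by (simp add: u_def)
    have "sum a F powr p \<le> u powr p + p * a Q * sum a F powr (p - 1)"
      using powr_diff_le[of u "sum a F" p] u psubset.prems(1)[OF Q(1)] assms(2) by (simp add: sumF)
    also have "u powr p \<le> p * (\<Sum>R\<in>F'. a R * (\<Sum>P | P \<in> F' \<and> R \<subseteq> P. a P) powr (p - 1))"
      unfolding u_def using psubset.prems Q F by (intro psubset.IH) auto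
    also have "(\<Sum>R\<in>F'. a R * (\<Sum>P | P \<in> F' \<and> R \<subseteq> P. a P) powr (p - 1))
        = (\<Sum>R\<in>F'. a R * (\<Sum>P | P \<in> F \<and> R \<subseteq> P. a P) powr (p - 1))"
    proof (rule sum.cong[OF refl])
      fix R assume "R \<in> F'"
      \<comment> \<open>By minimality \<open>R \<subseteq> Q\<close> would give
        \<open>R = Q\<close>, so \<open>Q\<close> occurs in no inner sum of the remaining
        sets.\<close>
      then have "{P. P \<in> F' \<and> R \<subseteq> P} = {P. P \<in> F \<and> R \<subseteq> P}"
        using Q(2)[of R] by (auto simp: F'_def)
      then show "a R * (\<Sum>P | P \<in> F' \<and> R \<subseteq> P. a P) powr (p - 1)
          = a R * (\<Sum>P | P \<in> F \<and> R \<subseteq> P. a P) powr (p - 1)" by simp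
    qed
    also have "p * (\<Sum>R\<in>F'. a R * (\<Sum>P | P \<in> F \<and> R \<subseteq> P. a P) powr (p - 1)) +
        p * a Q * sum a F powr (p - 1) = p * (\<Sum>R\<in>F. a R * (\<Sum>P | P \<in> F \<and> R \<subseteq> P. a P) powr (p - 1))"
    proof -
      have "{P. P \<in> F \<and> Q \<subseteq> P} = F" using below by auto
      then show ?thesis
        using sum.remove[OF psubset.hyps Q(1), of "\<lambda>R. a R * (\<Sum>P | P \<in> F \<and> R \<subseteq> P. a P) powr (p - 1)"]
        by (simp add: F'_def algebra_simps)
    qed
    finally show ?thesis by simp
  qed simp
qed

lemma overlap_sum_le:
  fixes f :: "'i \<Rightarrow> ennreal"
  assumes "finite F" "card {Q \<in> F. x \<in> G Q} \<le> m" "\<And>Q. Q \<in> F \<Longrightarrow> x \<in> G Q \<Longrightarrow> f Q \<le> s"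
  shows "(\<Sum>Q\<in>F. f Q * indicator (G Q) x) \<le> of_nat m * s"
proof -
  have "(\<Sum>Q\<in>F. f Q * indicator (G Q) x) = (\<Sum>Q | Q \<in> F \<and> x \<in> G Q. f Q)"
    using assms(1) by (intro sum.mono_neutral_cong_right) (auto simp: indicator_def)
  also have "\<dots> \<le> of_nat (card {Q \<in> F. x \<in> G Q}) * s"
    using assms by (intro sum_bounded_above) auto
  also have "\<dots> \<le> of_nat m * s" using assms(2) by (intro mult_right_mono) auto
  finally show ?thesis .
qed

text \<open>Finiteness of \<open>I\<close> is essential: the second hypothesis holds trivially for
  \<open>I = \<infinity>\<close>.\<close>

lemma ennreal_absorb_half:
  fixes I J :: ennreal
  assumes "I < top" "I \<le> I / 2 + J"
  shows "I \<le> 2 * J"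
proof (cases J)
  case (real j)
  obtain i where i: "I = ennreal i" "0 \<le> i" using assms(1) by (cases I) auto
  have "ennreal i \<le> ennreal (i / 2 + j)"
    using assms(2) i real by (simp add: divide_ennreal[symmetric, of i 2])
  then have "i \<le> i / 2 + j" using i real by (subst (asm) ennreal_le_iff) auto
  then have "i \<le> 2 * j" by simp
  then have "ennreal i \<le> ennreal (2 * j)" by (rule ennreal_leI)
  then show ?thesis using i real by (simp add: ennreal_mult)
next
  case top
  then show ?thesis by (simp add: ennreal_mult_top)
qed

text \<open>Initial segments of an enumeration, preparing the use of monotone convergence for
  infinite sums.\<close>

lemma countable_exhaustion:
  assumes "countable A"
  obtains H :: "nat \<Rightarrow> 'a set" where "incseq H" "\<And>n. finite (H n)" "(\<Union>n. H n) = A"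
proof
  let ?H = "\<lambda>n. {x \<in> A. to_nat_on A x < n}"
  show "incseq ?H" by (auto simp: incseq_def)
  show "finite (?H n)" for n
  proof (rule finite_imageD)
    show "finite (to_nat_on A ` ?H n)" by (rule finite_subset[of _ "{..<n}"]) auto
    show "inj_on (to_nat_on A) (?H n)"
      using inj_on_to_nat_on[OF assms] by (rule inj_on_subset) auto
  qed
  show "(\<Union>n. ?H n) = A" by auto
qed

lemma ennreal_infsum_le_SUP:
  fixes f :: "'a \<Rightarrow> ennreal"
  assumes "incseq H" "(\<Union>n. H n) = A" "\<And>n. finite (H n)"
  shows "infsum f A \<le> (SUP n. sum f (H n))"
proof (rule ennreal_infsum_leI)
  fix B assume B: "finite B" "B \<subseteq> A"
  have "\<exists>n. B \<subseteq> H n"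
    using B
  proof (induction B rule: finite_induct)
    case (insert x B)
    then obtain n k where "B \<subseteq> H n" "x \<in> H k" using assms(2) by blast
    then have "insert x B \<subseteq> H (max n k)"
      using incseqD[OF assms(1), of n "max n k"] incseqD[OF assms(1), of k "max n k"] by auto
    then show ?case by blast
  qed simp
  then obtain n where "B \<subseteq> H n" by blast
  then have "sum f B \<le> sum f (H n)" using assms(3) by (intro sum_mono2) auto
  also have "\<dots> \<le> (SUP n. sum f (H n))" by (rule SUP_upper) simp
  finally show "sum f B \<le> (SUP n. sum f (H n))" .
qed

text \<open>\<open>G Q\<close> replaces \<open>Q\<close> inside integrals: its measure is comparable
  to that of \<open>Q\<close>, while the sets \<open>G Q\<close> overlap at most \<open>m\<close>
  times. The instance of interest is \<open>G = deep\<close>.\<close>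

locale sparse_family =
  fixes M :: "'a measure" and F :: "'a set set" and G :: "'a set \<Rightarrow> 'a set" and A :: real and m :: nat
  assumes A: "0 \<le> A"
    and sets: "\<And>Q. Q \<in> F \<Longrightarrow> Q \<in> sets M" "\<And>Q. Q \<in> F \<Longrightarrow> G Q \<in> sets M"
    and G_subset: "\<And>Q. Q \<in> F \<Longrightarrow> G Q \<subseteq> Q"
    and finite_measure: "\<And>Q. Q \<in> F \<Longrightarrow> emeasure M Q < top"
    and large: "\<And>Q. Q \<in> F \<Longrightarrow> emeasure M Q \<le> ennreal A * emeasure M (G Q)"
    and overlap: "\<And>x. card {Q \<in> F. x \<in> G Q} \<le> m" "\<And>x. finite {Q \<in> F. x \<in> G Q}"
    and laminar: "\<And>P Q x. P \<in> F \<Longrightarrow> Q \<in> F \<Longrightarrow> x \<in> P \<Longrightarrow> x \<in> Q \<Longrightarrow> P \<subseteq> Q \<or> Q \<subseteq> P"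
begin

text \<open>For a finite family the integral \<open>I\<close> of \<open>t powr p\<close> is finite,
  so half of it can be absorbed. The resulting constant does not depend on the family
  \<open>H\<close>.\<close>

lemma finite_sum_powr_le:
  assumes fin: "finite H" and sub: "H \<subseteq> F" and p: "1 \<le> p" and a: "\<And>Q. Q \<in> H \<Longrightarrow> 0 \<le> a Q"
  shows "(\<integral>\<^sup>+ x. enn_powr (\<Sum>Q\<in>H. ennreal (a Q) * indicator Q x) p \<partial>M)
    \<le> ennreal (2 * (2 * (real m * A * p)) powr p) *
      (\<integral>\<^sup>+ x. enn_powr (SUP Q\<in>H. ennreal (a Q) * indicator Q x) p \<partial>M)"
proof -
  \<comment> \<open>The three losses: overlap \<open>m\<close>, replacement of \<open>Q\<close> by
    \<open>G Q\<close>, and the factor \<open>p\<close> of the chain inequality.\<close>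
  define D where "D = real m * A * p"
  define t where "t x = (\<Sum>Q\<in>H. a Q * indicator Q x)" for x
  define s where "s x = (SUP Q\<in>H. ennreal (a Q) * indicator Q x)" for x
  define T where "T Q = (\<Sum>P | P \<in> H \<and> Q \<subseteq> P. a P)" for Q
  define b where "b Q = p * a Q * T Q powr (p - 1)" for Q
  define I where "I = (\<integral>\<^sup>+ x. ennreal (t x powr p) \<partial>M)"
  define J where "J = (\<integral>\<^sup>+ x. enn_powr (s x) p \<partial>M)"
  have H [measurable]: "\<And>Q. Q \<in> H \<Longrightarrow> Q \<in> sets M" "\<And>Q. Q \<in> H \<Longrightarrow> G Q \<in> sets M"
    using sub sets by auto
  have D: "0 \<le> D" using A p by (simp add: D_def)
  have t_nonneg: "0 \<le> t x" for x unfolding t_def using a by (intro sum_nonneg) auto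
  have T_nonneg: "0 \<le> T Q" for Q unfolding T_def using a by (intro sum_nonneg) auto
  have b_nonneg: "0 \<le> b Q" if "Q \<in> H" for Q using a[OF that] p by (simp add: b_def)
  have t_meas [measurable]: "t \<in> borel_measurable M" unfolding t_def by measurable
  have s_meas [measurable]: "s \<in> borel_measurable M"
    unfolding s_def using fin by (intro borel_measurable_SUP) (auto simp: countable_finite)
  have t_restrict: "t x = (\<Sum>Q | Q \<in> H \<and> x \<in> Q. a Q)" for x
    unfolding t_def using fin by (intro sum.mono_neutral_cong_right) (auto simp: indicator_def)
  \<comment> \<open>Every member of \<open>H\<close> containing \<open>Q\<close> also contains
    \<open>x\<close>, so the sum \<open>T Q\<close> is part of \<open>t x\<close>.\<close>
  have T_le: "T Q \<le> t x" if "x \<in> Q" for Q x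
    unfolding T_def t_restrict using that fin a by (intro sum_mono2) auto
  have t_eq: "ennreal (t x) = (\<Sum>Q\<in>H. ennreal (a Q) * indicator Q x)" for x
  proof -
    have "(\<Sum>Q\<in>H. ennreal (a Q) * indicator Q x) = (\<Sum>Q\<in>H. ennreal (a Q * indicator Q x))"
      by (intro sum.cong) (auto simp: indicator_def)
    also have "\<dots> = ennreal (t x)" unfolding t_def using a by (intro sum_ennreal) auto
    finally show ?thesis by simp
  qed
  have pointwise: "ennreal (t x powr p) \<le> (\<Sum>Q\<in>H. ennreal (b Q) * indicator Q x)" for x
  proof -
    let ?H = "{Q \<in> H. x \<in> Q}"
    have "P \<subseteq> Q \<or> Q \<subseteq> P" if "P \<in> ?H" "Q \<in> ?H" for P Q
      using laminar[of P Q x] that sub by blast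
    then have "t x powr p \<le> p * (\<Sum>Q\<in>?H. a Q * (\<Sum>P | P \<in> ?H \<and> Q \<subseteq> P. a P) powr (p - 1))"
      unfolding t_restrict using fin p a by (intro chain_sum_powr) auto
    also have "\<dots> = (\<Sum>Q\<in>?H. b Q)"
      unfolding sum_distrib_left
    proof (rule sum.cong[OF refl])
      fix Q assume "Q \<in> ?H"
      then have "{P. P \<in> ?H \<and> Q \<subseteq> P} = {P. P \<in> H \<and> Q \<subseteq> P}" by auto
      then show "p * (a Q * (\<Sum>P | P \<in> ?H \<and> Q \<subseteq> P. a P) powr (p - 1)) = b Q"
        by (simp add: b_def T_def)
    qed
    finally have "ennreal (t x powr p) \<le> ennreal (\<Sum>Q\<in>?H. b Q)" by (rule ennreal_leI)
    also have "\<dots> = (\<Sum>Q\<in>?H. ennreal (b Q))" using b_nonneg by (intro sum_ennreal[symmetric]) auto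
    also have "\<dots> = (\<Sum>Q\<in>H. ennreal (b Q) * indicator Q x)"
      using fin by (intro sum.mono_neutral_cong_left) (auto simp: indicator_def)
    finally show ?thesis .
  qed
  have young: "(\<Sum>Q\<in>H. ennreal (A * b Q) * indicator (G Q) x)
      \<le> ennreal (t x powr p) / 2 + ennreal ((2 * D) powr p) * enn_powr (s x) p" for x
  proof (cases "s x")
    case (real r)
    have "(\<Sum>Q\<in>H. ennreal (A * b Q) * indicator (G Q) x) \<le> of_nat m * ennreal (A * (p * r * t x powr (p - 1)))"
    proof (rule overlap_sum_le[OF fin])
      have "card {Q \<in> H. x \<in> G Q} \<le> card {Q \<in> F. x \<in> G Q}"
        using sub overlap(2) by (intro card_mono) auto
      then show "card {Q \<in> H. x \<in> G Q} \<le> m" using overlap(1)[of x] by simp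
      fix Q assume Q: "Q \<in> H" "x \<in> G Q"
      then have x: "x \<in> Q" using G_subset sub by blast
      have "ennreal (a Q) * indicator Q x \<le> s x" unfolding s_def using Q(1) by (rule SUP_upper)
      then have "a Q \<le> r" using x real a[OF Q(1)] by simp
      moreover have "T Q powr (p - 1) \<le> t x powr (p - 1)"
        using T_le[OF x] T_nonneg p by (intro powr_mono2) auto
      ultimately have "b Q \<le> p * r * t x powr (p - 1)"
        unfolding b_def using p a[OF Q(1)] by (intro mult_mono) auto
      then show "ennreal (A * b Q) \<le> ennreal (A * (p * r * t x powr (p - 1)))"
        using A by (intro ennreal_leI mult_left_mono)
    qed
    also have "\<dots> = ennreal (D * r * t x powr (p - 1))"
      using A p real by (simp add: D_def ennreal_of_nat_eq_real_of_nat mult_ac flip: ennreal_mult)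
    also have "\<dots> \<le> ennreal (t x powr p / 2 + (2 * D) powr p * r powr p)"
      using D real t_nonneg p by (intro ennreal_leI young_powr)
    also have "\<dots> = ennreal (t x powr p) / 2 + ennreal ((2 * D) powr p) * enn_powr (s x) p"
      using real by (simp add: enn_powr_ennreal ennreal_mult divide_ennreal[symmetric])
    finally show ?thesis .
  next
    \<comment> \<open>An infinite \<open>s x\<close> makes the right side infinite unless its
      coefficient is zero; with \<open>D = 0\<close> the left sum vanishes.\<close>
    case top
    show ?thesis
    proof (cases "D = 0")
      case True
      then have "m = 0 \<or> A = 0" using p by (simp add: D_def)
      then have "(\<Sum>Q\<in>H. ennreal (A * b Q) * indicator (G Q) x) = 0"
      proof
        assume "m = 0"
        then have "{Q \<in> F. x \<in> G Q} = {}" using overlap[of x] by simp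
        then show ?thesis using sub by (intro sum.neutral) (auto simp: indicator_def)
      qed simp
      then show ?thesis by simp
    qed (use top D in \<open>simp add: ennreal_mult_top\<close>)
  qed
  have "I \<le> (\<integral>\<^sup>+ x. (\<Sum>Q\<in>H. ennreal (b Q) * indicator Q x) \<partial>M)"
    unfolding I_def by (intro nn_integral_mono pointwise)
  also have "\<dots> = (\<Sum>Q\<in>H. ennreal (b Q) * emeasure M Q)"
    by (subst nn_integral_sum) (auto simp: nn_integral_cmult_indicator)
  also have "\<dots> \<le> (\<Sum>Q\<in>H. ennreal (A * b Q) * emeasure M (G Q))"
  proof (rule sum_mono)
    fix Q assume "Q \<in> H"
    then have "ennreal (b Q) * emeasure M Q \<le> ennreal (b Q) * (ennreal A * emeasure M (G Q))"
      using sub by (intro mult_left_mono large) auto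
    then show "ennreal (b Q) * emeasure M Q \<le> ennreal (A * b Q) * emeasure M (G Q)"
      using A by (simp add: ennreal_mult' mult_ac)
  qed
  also have "\<dots> = (\<integral>\<^sup>+ x. (\<Sum>Q\<in>H. ennreal (A * b Q) * indicator (G Q) x) \<partial>M)"
    by (subst nn_integral_sum) (auto simp: nn_integral_cmult_indicator)
  also have "\<dots> \<le> (\<integral>\<^sup>+ x. ennreal (t x powr p) / 2 + ennreal ((2 * D) powr p) * enn_powr (s x) p \<partial>M)"
    by (intro nn_integral_mono young)
  also have "\<dots> = I / 2 + ennreal ((2 * D) powr p) * J"
    unfolding I_def J_def by (subst nn_integral_add) (auto simp: nn_integral_divide nn_integral_cmult)
  finally have le: "I \<le> I / 2 + ennreal ((2 * D) powr p) * J" .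
  \<comment> \<open>Finiteness of \<open>I\<close>: \<open>t\<close> is bounded by
    \<open>sum a H\<close> and vanishes off a set of finite measure.\<close>
  have "I \<le> (\<integral>\<^sup>+ x. ennreal (sum a H powr p) * indicator (\<Union>H) x \<partial>M)"
    unfolding I_def
  proof (rule nn_integral_mono)
    fix x
    show "ennreal (t x powr p) \<le> ennreal (sum a H powr p) * indicator (\<Union>H) x"
    proof (cases "x \<in> \<Union>H")
      case True
      have "t x \<le> sum a H" unfolding t_restrict using fin a by (intro sum_mono2) auto
      then show ?thesis using True t_nonneg p by (simp add: ennreal_leI powr_mono2)
    next
      case False
      then have "t x = 0" unfolding t_def by (intro sum.neutral) (auto simp: indicator_def)
      then show ?thesis by simp
    qed
  qed
  also have "\<dots> = ennreal (sum a H powr p) * emeasure M (\<Union>H)"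
    using fin H by (intro nn_integral_cmult_indicator sets.finite_Union) auto
  also have "\<dots> < top"
  proof -
    have "H \<subseteq> sets M" using H(1) by blast
    then have "emeasure M (\<Union>H) \<le> (\<Sum>Q\<in>H. emeasure M Q)"
      using emeasure_subadditive_finite[of H "\<lambda>Q. Q" M] fin by simp
    also have "\<dots> < top" using fin sub finite_measure by (subst ennreal_sum_less_top) auto
    finally show ?thesis by (simp add: ennreal_mult_less_top)
  qed
  finally have "I \<le> 2 * (ennreal ((2 * D) powr p) * J)" using le by (intro ennreal_absorb_half)
  then show ?thesis
    unfolding I_def J_def s_def D_def by (simp add: t_nonneg enn_powr_ennreal ennreal_mult mult_ac flip: t_eq)
qed

text \<open>Integrate the overlap bound: the indicators of the sets \<open>G Q\<close> add up to at
  most \<open>m\<close> on \<open>B\<close> and to zero outside.\<close>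

lemma sum_emeasure_le:
  assumes "finite H" "H \<subseteq> F" "B \<in> sets M" "\<And>Q. Q \<in> F \<Longrightarrow> Q \<subseteq> B"
  shows "(\<Sum>Q\<in>H. emeasure M (G Q)) \<le> of_nat m * emeasure M B"
proof -
  have [measurable]: "Q \<in> H \<Longrightarrow> G Q \<in> sets M" for Q using assms(2) sets by auto
  have "(\<Sum>Q\<in>H. emeasure M (G Q)) = (\<integral>\<^sup>+ x. (\<Sum>Q\<in>H. 1 * indicator (G Q) x) \<partial>M)"
    by (subst nn_integral_sum) auto
  also have "\<dots> \<le> (\<integral>\<^sup>+ x. of_nat m * indicator B x \<partial>M)"
  proof (rule nn_integral_mono)
    fix x
    have "card {Q \<in> H. x \<in> G Q} \<le> card {Q \<in> F. x \<in> G Q}"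
      using assms(2) overlap(2) by (intro card_mono) auto
    then have "card {Q \<in> H. x \<in> G Q} \<le> m" using overlap(1)[of x] by simp
    moreover have "x \<in> B" if "Q \<in> H" "x \<in> G Q" for Q
      using that assms G_subset by blast
    ultimately show "(\<Sum>Q\<in>H. 1 * indicator (G Q) x) \<le> of_nat m * (indicator B x :: ennreal)"
      using assms(1) by (intro overlap_sum_le) auto
  qed
  also have "\<dots> = of_nat m * emeasure M B" using assms(3) by (rule nn_integral_cmult_indicator)
  finally show ?thesis .
qed

text \<open>The finite case has a uniform constant, so it passes to the limit along an exhaustion by
  monotone convergence; the supremum only grows with the family.\<close>

lemma infsum_powr_le:
  assumes "countable F" and p: "1 \<le> p" and a: "\<And>Q. Q \<in> F \<Longrightarrow> 0 \<le> a Q"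
  shows "(\<integral>\<^sup>+ x. enn_powr (\<Sum>\<^sub>\<infinity>Q\<in>F. ennreal (a Q) * indicator Q x) p \<partial>M)
    \<le> ennreal (2 * (2 * (real m * A * p)) powr p) *
      (\<integral>\<^sup>+ x. enn_powr (SUP Q\<in>F. ennreal (a Q) * indicator Q x) p \<partial>M)"
proof -
  obtain H where H: "incseq H" "\<And>n. finite (H n)" "(\<Union>n. H n) = F"
    using countable_exhaustion[OF assms(1)] by blast
  have sub: "H n \<subseteq> F" for n using H(3) by blast
  define t where "t n x = (\<Sum>Q\<in>H n. ennreal (a Q) * indicator Q x)" for n x
  have [measurable]: "t n \<in> borel_measurable M" for n
    unfolding t_def using sub[of n] sets by (intro borel_measurable_sum) auto
  have "(\<integral>\<^sup>+ x. enn_powr (\<Sum>\<^sub>\<infinity>Q\<in>F. ennreal (a Q) * indicator Q x) p \<partial>M)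
      \<le> (\<integral>\<^sup>+ x. (SUP n. enn_powr (t n x) p) \<partial>M)"
  proof (rule nn_integral_mono)
    fix x
    have "enn_powr (\<Sum>\<^sub>\<infinity>Q\<in>F. ennreal (a Q) * indicator Q x) p \<le> enn_powr (SUP n. t n x) p"
      unfolding t_def using p H by (intro enn_powr_mono ennreal_infsum_le_SUP) auto
    also have "\<dots> \<le> (SUP n. enn_powr (t n x) p)" using p by (intro enn_powr_SUP_le) simp
    finally show "enn_powr (\<Sum>\<^sub>\<infinity>Q\<in>F. ennreal (a Q) * indicator Q x) p \<le> (SUP n. enn_powr (t n x) p)" .
  qed
  also have "\<dots> = (SUP n. \<integral>\<^sup>+ x. enn_powr (t n x) p \<partial>M)"
  proof (rule nn_integral_monotone_convergence_SUP)
    show "incseq (\<lambda>n x. enn_powr (t n x) p)"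
      unfolding incseq_def le_fun_def t_def using p H
      by (intro allI impI enn_powr_mono sum_mono2) (auto dest: incseqD)
  qed measurable
  also have "\<dots> \<le> ennreal (2 * (2 * (real m * A * p)) powr p) *
      (\<integral>\<^sup>+ x. enn_powr (SUP Q\<in>F. ennreal (a Q) * indicator Q x) p \<partial>M)"
  proof (rule SUP_least)
    fix n
    have "(\<integral>\<^sup>+ x. enn_powr (t n x) p \<partial>M) \<le> ennreal (2 * (2 * (real m * A * p)) powr p) *
      (\<integral>\<^sup>+ x. enn_powr (SUP Q\<in>H n. ennreal (a Q) * indicator Q x) p \<partial>M)"
      unfolding t_def using sub[of n] a by (intro finite_sum_powr_le H(2) p) auto
    also have "\<dots> \<le> ennreal (2 * (2 * (real m * A * p)) powr p) *
      (\<integral>\<^sup>+ x. enn_powr (SUP Q\<in>F. ennreal (a Q) * indicator Q x) p \<partial>M)"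
      using sub[of n] p by (intro mult_left_mono nn_integral_mono enn_powr_mono SUP_subset_mono) auto
    finally show "(\<integral>\<^sup>+ x. enn_powr (t n x) p \<partial>M) \<le> ennreal (2 * (2 * (real m * A * p)) powr p) *
      (\<integral>\<^sup>+ x. enn_powr (SUP Q\<in>F. ennreal (a Q) * indicator Q x) p \<partial>M)" .
  qed
  finally show ?thesis .
qed

end

section \<open>The equivalences\<close>

lemma (in lattice_of_cubes) countable_near_cubes_in:
  assumes "R \<in> \<D>"
  shows "countable (near_cubes_in \<D> \<gamma> E R)"
proof (rule countable_subset)
  show "near_cubes_in \<D> \<gamma> E R \<subseteq> (\<Union>j. subcubes j R)"
  proof
    fix Q assume "Q \<in> near_cubes_in \<D> \<gamma> E R"
    then have "Q \<in> \<D>" "Q \<subseteq> R" by (auto simp: near_cubes_in_def near_cubes_def)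
    then show "Q \<in> (\<Union>j. subcubes j R)" 
      using subset_level[OF \<open>Q \<in> \<D>\<close> assms \<open>Q \<subseteq> R\<close>] by blast
  qed
  show "countable (\<Union>j. subcubes j R)"
    using finite_subcubes[OF cube_mem[OF assms]] by (auto intro: countable_finite)
qed

text \<open>Collects one exponent and one constant for all later estimates. Going from
  \<open>\<mu>(Q)\<close> to the volume power and from there to the deep part costs \<open>A\<close>
  each time, hence the constant \<open>A * A\<close>.\<close>

lemma (in porous_lattice) near_cubes_sparse:
  assumes "0 < \<gamma>"
  obtains \<alpha> A m where "0 < \<alpha>" "0 < A" "dist_weight \<alpha> E"
    "\<And>R. R \<in> \<D> \<Longrightarrow> emeasure (dist_measure \<alpha> E) R
      \<le> ennreal (A * measure lborel R powr (1 - \<alpha> / real CARD('n)))"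
    "\<And>Q. Q \<in> near_cubes \<D> \<gamma> E \<Longrightarrow> ennreal (measure lborel Q powr (1 - \<alpha> / real CARD('n)))
      \<le> ennreal A * emeasure (dist_measure \<alpha> E) (deep Q)"
    "\<And>R. R \<in> \<D> \<Longrightarrow>
      sparse_family (dist_measure \<alpha> E) (near_cubes_in \<D> \<gamma> E R) deep (A * A) m"
proof -
  obtain \<alpha> C where \<alpha>: "0 < \<alpha>" and C: "0 < C"
    "\<And>R. R \<in> \<D> \<Longrightarrow> emeasure (dist_measure \<alpha> E) R \<le> ennreal (C * side R powr (real CARD('n) - \<alpha>))"
    by (rule dist_measure_cubes) (rule that; assumption | blast)
  obtain m where m: "4 * \<eta> * (1 + \<gamma>) < 2 ^ m"
    using real_arch_pow[of 2 "4 * \<eta> * (1 + \<gamma>)"] by auto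
  define c where "c = \<kappa> * (1 + \<gamma>) powr - \<alpha>"
  \<comment> \<open>\<open>C\<close> serves the upper bound for cubes, \<open>1 / c\<close> the
    lower bound for deep parts.\<close>
  define A where "A = max C (1 / c)"
  have c: "0 < c" using \<kappa> assms by (simp add: c_def)
  have A: "0 < A" "C \<le> A" "1 \<le> A * c" using C(1) c by (auto simp: A_def max_def field_simps)
  have upper: "emeasure (dist_measure \<alpha> E) R \<le> ennreal (A * measure lborel R powr (1 - \<alpha> / real CARD('n)))"
    if "R \<in> \<D>" for R
  proof -
    have "emeasure (dist_measure \<alpha> E) R \<le> ennreal (C * side R powr (real CARD('n) - \<alpha>))"
      using that by (rule C(2))
    also have "\<dots> \<le> ennreal (A * side R powr (real CARD('n) - \<alpha>))"
      using A by (intro ennreal_leI mult_right_mono) auto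
    finally show ?thesis using cube_mem[OF that] by (simp add: is_cube_measure_powr)
  qed
  have lower: "ennreal (measure lborel Q powr (1 - \<alpha> / real CARD('n)))
      \<le> ennreal A * emeasure (dist_measure \<alpha> E) (deep Q)" if "Q \<in> near_cubes \<D> \<gamma> E" for Q
  proof -
    have "is_cube Q" using that cube_mem by (auto simp: near_cubes_def)
    then have "ennreal (measure lborel Q powr (1 - \<alpha> / real CARD('n))) = ennreal (1 * side Q powr (real CARD('n) - \<alpha>))"
      by (simp add: is_cube_measure_powr)
    also have "\<dots> \<le> ennreal (A * c * side Q powr (real CARD('n) - \<alpha>))"
      using A by (intro ennreal_leI mult_right_mono) auto
    also have "\<dots> = ennreal A * ennreal (c * side Q powr (real CARD('n) - \<alpha>))"
      using A by (simp add: ennreal_mult' mult.assoc)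
    also have "\<dots> \<le> ennreal A * emeasure (dist_measure \<alpha> E) (deep Q)"
      using dist_measure_deep[OF \<alpha> assms that] by (intro mult_left_mono) (auto simp: c_def)
    finally show ?thesis .
  qed
  have weight: "dist_weight \<alpha> E"
    unfolding dist_weight_def
  proof (intro allI impI)
    fix K :: "(real ^ 'n) set" assume "compact K"
    then obtain Q where Q: "Q \<in> \<D>" "K \<subseteq> Q" using compact_covered by blast
    have "emeasure (dist_measure \<alpha> E) K \<le> emeasure (dist_measure \<alpha> E) Q"
      using Q cube_mem by (intro emeasure_mono) (auto simp: is_cube_borel)
    also have "\<dots> < \<infinity>" using upper[OF Q(1)] by (simp add: order.strict_trans1 ennreal_less_top)
    finally show "emeasure (dist_measure \<alpha> E) K < \<infinity>" .
  qed
  have "sparse_family (dist_measure \<alpha> E) (near_cubes_in \<D> \<gamma> E R) deep (A * A) m" if R: "R \<in> \<D>" for R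
  proof
    fix Q assume Q: "Q \<in> near_cubes_in \<D> \<gamma> E R"
    then have near: "Q \<in> \<D>" "Q \<in> near_cubes \<D> \<gamma> E" by (auto simp: near_cubes_in_def near_cubes_def)
    then have cube: "is_cube Q" using cube_mem by simp
    show "Q \<in> sets (dist_measure \<alpha> E)" "deep Q \<in> sets (dist_measure \<alpha> E)"
      using cube is_cube_borel deep_borel by auto
    show "deep Q \<subseteq> Q" by (auto simp: deep_def)
    show "emeasure (dist_measure \<alpha> E) Q < top"
      using dist_weight_cube_finite[OF weight cube] by simp
    have "emeasure (dist_measure \<alpha> E) Q \<le> ennreal A * ennreal (measure lborel Q powr (1 - \<alpha> / real CARD('n)))"
      using upper[OF near(1)] A by (simp add: ennreal_mult')
    also have "\<dots> \<le> ennreal A * (ennreal A * emeasure (dist_measure \<alpha> E) (deep Q))"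
      by (intro mult_left_mono lower near) auto
    finally show "emeasure (dist_measure \<alpha> E) Q \<le> ennreal (A * A) * emeasure (dist_measure \<alpha> E) (deep Q)"
      using A by (simp add: ennreal_mult' mult.assoc)
  next
    fix x
    show "card {Q \<in> near_cubes_in \<D> \<gamma> E R. x \<in> deep Q} \<le> m" "finite {Q \<in> near_cubes_in \<D> \<gamma> E R. x \<in> deep Q}"
      using deep_overlap[OF assms m R order_refl] by auto
  next
    fix P Q x assume "P \<in> near_cubes_in \<D> \<gamma> E R" "Q \<in> near_cubes_in \<D> \<gamma> E R" "x \<in> P" "x \<in> Q"
    then show "P \<subseteq> Q \<or> Q \<subseteq> P"
      by (intro comparable[of P Q x]) (auto simp: near_cubes_in_def near_cubes_def)
  qed (use A in auto)
  from that[OF \<alpha> A(1) weight upper lower this] show thesis .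
qed

lemma porousE:
  assumes "dyadic_lattice \<D>" "porous \<D> E"
  obtains \<eta> where "porous_lattice \<D> E \<eta>"
  using assms unfolding porous_def
  by (auto simp: porous_lattice_def lattice_of_cubes_def porous_lattice_axioms_def)

text \<open>The terms of (i) and (ii) are compared with deep parts, whose total measure inside
  \<open>R\<close> is at most \<open>m * \<mu>(R)\<close>. For (i) this is converted back to the
  volume power of \<open>R\<close>. The third estimate is the sparse inequality after a
  \<open>p\<close>-th root.\<close>

lemma porous_imp_sums:
  fixes \<D> :: "(real ^ 'n) set set"
  assumes "dyadic_lattice \<D>" "0 < \<gamma>" "porous \<D> E"
  obtains \<alpha> \<zeta> where "0 < \<alpha>" "0 < \<zeta>" "dist_weight \<alpha> E"
    "\<And>R. R \<in> \<D> \<Longrightarrow>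
      (\<Sum>\<^sub>\<infinity>Q\<in>near_cubes_in \<D> \<gamma> E R. ennreal (measure lborel Q powr (1 - \<alpha> / real CARD('n))))
        \<le> ennreal (\<zeta> * measure lborel R powr (1 - \<alpha> / real CARD('n)))"
    "\<And>R. R \<in> \<D> \<Longrightarrow>
      (\<Sum>\<^sub>\<infinity>Q\<in>near_cubes_in \<D> \<gamma> E R. emeasure (dist_measure \<alpha> E) Q)
        \<le> ennreal \<zeta> * emeasure (dist_measure \<alpha> E) R"
    "\<And>p R a. 1 \<le> p \<Longrightarrow> R \<in> \<D> \<Longrightarrow> (\<And>Q. Q \<in> near_cubes_in \<D> \<gamma> E R \<Longrightarrow> 0 \<le> a Q) \<Longrightarrow>
      wnorm p \<alpha> E (\<lambda>x. \<Sum>\<^sub>\<infinity>Q\<in>near_cubes_in \<D> \<gamma> E R. ennreal (a Q) * indicator Q x)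
        \<le> ennreal ((2 * (2 * (\<zeta> * p)) powr p) powr (1 / p)) *
          wnorm p \<alpha> E (\<lambda>x. SUP Q\<in>near_cubes_in \<D> \<gamma> E R. ennreal (a Q) * indicator Q x)"
proof -
  obtain \<eta> where "porous_lattice \<D> E \<eta>" using porousE[OF assms(1,3)] .
  then interpret porous_lattice \<D> E \<eta> .
  obtain \<alpha> A m where \<alpha>: "0 < \<alpha>" "0 < A" and weight: "dist_weight \<alpha> E"
    and upper: "\<And>R. R \<in> \<D> \<Longrightarrow> emeasure (dist_measure \<alpha> E) R
      \<le> ennreal (A * measure lborel R powr (1 - \<alpha> / real CARD('n)))"
    and lower: "\<And>Q. Q \<in> near_cubes \<D> \<gamma> E \<Longrightarrow> ennreal (measure lborel Q powr (1 - \<alpha> / real CARD('n)))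
      \<le> ennreal A * emeasure (dist_measure \<alpha> E) (deep Q)"
    and sparse: "\<And>R. R \<in> \<D> \<Longrightarrow>
      sparse_family (dist_measure \<alpha> E) (near_cubes_in \<D> \<gamma> E R) deep (A * A) m"
    by (rule near_cubes_sparse[OF assms(2)]) (rule that; assumption | blast)
  let ?\<mu> = "dist_measure \<alpha> E"
  let ?v = "\<lambda>Q :: (real ^ 'n) set. measure lborel Q powr (1 - \<alpha> / real CARD('n))"
  \<comment> \<open>The summand 1 makes \<open>\<zeta>\<close> positive whatever \<open>m\<close>
    is.\<close>
  define \<zeta> where "\<zeta> = (real m + 1) * (A * A)"
  have \<zeta>: "0 < \<zeta>" using \<alpha> by (simp add: \<zeta>_def)
  have packing: "(\<Sum>Q\<in>H. ennreal (A * A) * emeasure ?\<mu> (deep Q)) \<le> ennreal \<zeta> * emeasure ?\<mu> R"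
    and packing': "(\<Sum>Q\<in>H. ennreal A * emeasure ?\<mu> (deep Q)) \<le> ennreal ((real m + 1) * A) * emeasure ?\<mu> R"
    if "R \<in> \<D>" "finite H" "H \<subseteq> near_cubes_in \<D> \<gamma> E R" for R H
  proof -
    have "(\<Sum>Q\<in>H. emeasure ?\<mu> (deep Q)) \<le> of_nat m * emeasure ?\<mu> R"
      using that cube_mem[OF that(1)]
      by (intro sparse_family.sum_emeasure_le[OF sparse]) (auto simp: is_cube_borel near_cubes_in_def)
    also have "\<dots> \<le> ennreal (real m + 1) * emeasure ?\<mu> R"
      unfolding ennreal_of_nat_eq_real_of_nat by (intro mult_right_mono ennreal_leI) auto
    finally have le: "(\<Sum>Q\<in>H. emeasure ?\<mu> (deep Q)) \<le> ennreal (real m + 1) * emeasure ?\<mu> R" .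
    have "(\<Sum>Q\<in>H. ennreal B * emeasure ?\<mu> (deep Q)) \<le> ennreal ((real m + 1) * B) * emeasure ?\<mu> R" for B
    proof -
      have "(\<Sum>Q\<in>H. ennreal B * emeasure ?\<mu> (deep Q)) = ennreal B * (\<Sum>Q\<in>H. emeasure ?\<mu> (deep Q))"
        by (simp add: sum_distrib_left)
      also have "\<dots> \<le> ennreal B * (ennreal (real m + 1) * emeasure ?\<mu> R)"
        using le by (rule mult_left_mono) simp
      also have "\<dots> = ennreal ((real m + 1) * B) * emeasure ?\<mu> R"
        by (subst ennreal_mult') (simp_all add: mult_ac)
      finally show ?thesis .
    qed
    from this[of "A * A"] this[of A]
    show "(\<Sum>Q\<in>H. ennreal (A * A) * emeasure ?\<mu> (deep Q)) \<le> ennreal \<zeta> * emeasure ?\<mu> R"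
      "(\<Sum>Q\<in>H. ennreal A * emeasure ?\<mu> (deep Q)) \<le> ennreal ((real m + 1) * A) * emeasure ?\<mu> R"
      by (simp_all add: \<zeta>_def)
  qed
  show thesis
  proof (rule that[OF \<alpha>(1) \<zeta> weight])
    fix R assume R: "R \<in> \<D>"
    let ?N = "near_cubes_in \<D> \<gamma> E R"
    show "(\<Sum>\<^sub>\<infinity>Q\<in>?N. ennreal (?v Q)) \<le> ennreal (\<zeta> * ?v R)"
    proof (rule ennreal_infsum_leI)
      fix H assume H: "finite H" "H \<subseteq> ?N"
      have "(\<Sum>Q\<in>H. ennreal (?v Q)) \<le> (\<Sum>Q\<in>H. ennreal A * emeasure ?\<mu> (deep Q))"
        using H by (intro sum_mono lower) (auto simp: near_cubes_in_def)
      also have "\<dots> \<le> ennreal ((real m + 1) * A) * emeasure ?\<mu> R" by (rule packing'[OF R H])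
      also have "\<dots> \<le> ennreal ((real m + 1) * A) * ennreal (A * ?v R)"
        by (intro mult_left_mono upper R) auto
      also have "\<dots> = ennreal (\<zeta> * ?v R)"
        using \<alpha> by (simp add: \<zeta>_def mult_ac flip: ennreal_mult)
      finally show "(\<Sum>Q\<in>H. ennreal (?v Q)) \<le> ennreal (\<zeta> * ?v R)" .
    qed
    show "(\<Sum>\<^sub>\<infinity>Q\<in>?N. emeasure ?\<mu> Q) \<le> ennreal \<zeta> * emeasure ?\<mu> R"
    proof (rule ennreal_infsum_leI)
      fix H assume H: "finite H" "H \<subseteq> ?N"
      have "(\<Sum>Q\<in>H. emeasure ?\<mu> Q) \<le> (\<Sum>Q\<in>H. ennreal (A * A) * emeasure ?\<mu> (deep Q))"
        using H by (intro sum_mono sparse_family.large[OF sparse[OF R]]) auto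
      also have "\<dots> \<le> ennreal \<zeta> * emeasure ?\<mu> R" by (rule packing[OF R H])
      finally show "(\<Sum>Q\<in>H. emeasure ?\<mu> Q) \<le> ennreal \<zeta> * emeasure ?\<mu> R" .
    qed
  next
    fix p :: real and R and a :: "(real ^ 'n) set \<Rightarrow> real"
    assume p: "1 \<le> p" and R: "R \<in> \<D>" and a: "\<And>Q. Q \<in> near_cubes_in \<D> \<gamma> E R \<Longrightarrow> 0 \<le> a Q"
    let ?N = "near_cubes_in \<D> \<gamma> E R"
    let ?J = "\<integral>\<^sup>+ x. enn_powr (SUP Q\<in>?N. ennreal (a Q) * indicator Q x) p \<partial>?\<mu>"
    define K where "K = 2 * (2 * (\<zeta> * p)) powr p"
    have K: "0 < K" using \<zeta> p by (simp add: K_def)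
    have "2 * (2 * (real m * (A * A) * p)) powr p \<le> K"
      unfolding K_def \<zeta>_def using p \<alpha> by (intro mult_left_mono powr_mono2 mult_right_mono) auto
    moreover have "(\<integral>\<^sup>+ x. enn_powr (\<Sum>\<^sub>\<infinity>Q\<in>?N. ennreal (a Q) * indicator Q x) p \<partial>?\<mu>)
        \<le> ennreal (2 * (2 * (real m * (A * A) * p)) powr p) * ?J"
      by (rule sparse_family.infsum_powr_le[OF sparse[OF R] countable_near_cubes_in[OF R] p a])
    ultimately have "(\<integral>\<^sup>+ x. enn_powr (\<Sum>\<^sub>\<infinity>Q\<in>?N. ennreal (a Q) * indicator Q x) p \<partial>?\<mu>) \<le> ennreal K * ?J"
      by (meson ennreal_leI mult_right_mono order_trans zero_le)
    then have "wnorm p \<alpha> E (\<lambda>x. \<Sum>\<^sub>\<infinity>Q\<in>?N. ennreal (a Q) * indicator Q x) \<le> enn_powr (ennreal K * ?J) (1 / p)"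
      unfolding wnorm_def using p by (intro enn_powr_mono) auto
    also have "\<dots> = ennreal (K powr (1 / p)) * wnorm p \<alpha> E (\<lambda>x. SUP Q\<in>?N. ennreal (a Q) * indicator Q x)"
      unfolding wnorm_def using K by (rule enn_powr_mult)
    finally show "wnorm p \<alpha> E (\<lambda>x. \<Sum>\<^sub>\<infinity>Q\<in>?N. ennreal (a Q) * indicator Q x)
        \<le> ennreal ((2 * (2 * (\<zeta> * p)) powr p) powr (1 / p)) *
          wnorm p \<alpha> E (\<lambda>x. SUP Q\<in>?N. ennreal (a Q) * indicator Q x)"
      unfolding K_def .
  qed
qed

section \<open>From the estimates back to porosity\<close>

lemma porous_of_powr_sum:
  fixes \<D> :: "(real ^ 'n) set set"
  assumes "dyadic_lattice \<D>" "E \<noteq> {}" "0 < \<gamma>" "0 < \<alpha>" "0 < \<zeta>"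
    and le: "\<And>R. R \<in> \<D> \<Longrightarrow>
      (\<Sum>\<^sub>\<infinity>Q\<in>near_cubes_in \<D> \<gamma> E R. ennreal (measure lborel Q powr (1 - \<alpha> / real CARD('n))))
        \<le> ennreal (\<zeta> * measure lborel R powr (1 - \<alpha> / real CARD('n)))"
  shows "porous \<D> E"
proof -
  interpret lattice_of_cubes \<D> using assms(1) by unfold_locales
  show ?thesis
  proof (rule porous_of_near_sum_le[OF assms(2,3)])
    fix R assume "R \<in> \<D>"
    then have R: "is_cube R" by (rule cube_mem)
    let ?w = "\<lambda>Q :: (real ^ 'n) set. ennreal (measure lborel Q powr (1 - \<alpha> / real CARD('n)))"
    have pos: "0 < measure lborel R" using R side_pos[OF R] by (simp add: is_cube_measure)
    then show "0 < ?w R" by simp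
    show "?w R < \<infinity>" by simp
    show "(\<Sum>\<^sub>\<infinity>Q\<in>near_cubes_in \<D> \<gamma> E R. ?w Q) \<le> ennreal \<zeta> * ?w R"
      using le[OF \<open>R \<in> \<D>\<close>] assms(5) by (simp add: ennreal_mult')
    fix k
    define r where "r = side R powr - \<alpha>"
    \<comment> \<open>Writing the volume power as \<open>side Q powr - \<alpha>\<close> times the
      volume shows that each generation sums to at least \<open>?w R\<close>: volume is additive,
      and the other factor grows as cubes shrink because \<open>\<alpha> > 0\<close>.\<close>
    have w_eq: "?w Q = ennreal (side Q powr - \<alpha>) * emeasure lborel Q" if "is_cube Q" for Q :: "(real ^ 'n) set"
    proof -
      have "side Q powr (real CARD('n) - \<alpha>) = side Q powr - \<alpha> * side Q ^ CARD('n)"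
        using side_pos[OF that] by (simp add: powr_diff powr_minus powr_realpow field_simps)
      then show ?thesis
        unfolding is_cube_measure_powr[OF that] is_cube_emeasure[OF that] by (simp add: ennreal_mult')
    qed
    have "?w R = ennreal r * emeasure lborel R" using w_eq[OF R] by (simp add: r_def)
    also have "\<dots> = (\<Sum>Q\<in>subcubes k R. ennreal r * emeasure lborel Q)"
      using sum_emeasure_subcubes[OF R, of lborel k] by (simp add: sum_distrib_left[symmetric])
    also have "\<dots> \<le> (\<Sum>Q\<in>subcubes k R. ?w Q)"
    proof (rule sum_mono)
      fix Q assume Q: "Q \<in> subcubes k R"
      have cQ: "is_cube Q" "side Q = side R / 2 ^ k" using subcubes_props[OF R Q] by auto
      have "side Q \<le> side R"
        using divide_left_mono[of 1 "2 ^ k" "side R"] cQ(2) side_pos[OF R] by simp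
      then have "r \<le> side Q powr - \<alpha>"
        unfolding r_def using side_pos[OF cQ(1)] assms(4) by (intro powr_mono2') auto
      then have "ennreal r * emeasure lborel Q \<le> ennreal (side Q powr - \<alpha>) * emeasure lborel Q"
        by (intro mult_right_mono ennreal_leI) auto
      also have "\<dots> = ?w Q" using w_eq[OF cQ(1)] by simp
      finally show "ennreal r * emeasure lborel Q \<le> ?w Q" .
    qed
    finally show "?w R \<le> (\<Sum>Q\<in>subcubes k R. ?w Q)" .
  qed
qed

text \<open>Here each generation sums to exactly the measure of \<open>R\<close>; positivity comes
  from the density and finiteness from \<open>dist_weight\<close>.\<close>

lemma porous_of_measure_sum:
  fixes \<D> :: "(real ^ 'n) set set"
  assumes "dyadic_lattice \<D>" "E \<noteq> {}" "0 < \<gamma>" "dist_weight \<alpha> E"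
    and le: "\<And>R. R \<in> \<D> \<Longrightarrow> (\<Sum>\<^sub>\<infinity>Q\<in>near_cubes_in \<D> \<gamma> E R. emeasure (dist_measure \<alpha> E) Q)
        \<le> ennreal \<xi> * emeasure (dist_measure \<alpha> E) R"
  shows "porous \<D> E"
proof -
  interpret lattice_of_cubes \<D> using assms(1) by unfold_locales
  show ?thesis
  proof (rule porous_of_near_sum_le[OF assms(2,3) _ _ _ le])
    fix R assume "R \<in> \<D>"
    then have R: "is_cube R" by (rule cube_mem)
    show "0 < emeasure (dist_measure \<alpha> E) R"
      using assms(2) R side_pos[OF R] by (intro dist_measure_pos) (auto simp: is_cube_borel is_cube_emeasure)
    show "emeasure (dist_measure \<alpha> E) R < \<infinity>" using assms(4) R by (rule dist_weight_cube_finite)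
    show "emeasure (dist_measure \<alpha> E) R \<le> (\<Sum>Q\<in>subcubes k R. emeasure (dist_measure \<alpha> E) Q)" for k
      using R by (simp add: sum_emeasure_subcubes)
  qed
qed

text \<open>With \<open>p = 1\<close> and unit coefficients, the left norm integrates the number of
  near cubes through \<open>x\<close>, and the supremum on the right is at most the indicator of
  \<open>R\<close>.\<close>

lemma measure_sum_of_norm:
  fixes \<D> :: "(real ^ 'n) set set"
  assumes "dyadic_lattice \<D>" "R \<in> \<D>"
    and le: "wnorm 1 \<alpha> E (\<lambda>x. \<Sum>\<^sub>\<infinity>Q\<in>near_cubes_in \<D> \<gamma> E R. ennreal 1 * indicator Q x)
      \<le> ennreal C * wnorm 1 \<alpha> E (\<lambda>x. SUP Q\<in>near_cubes_in \<D> \<gamma> E R. ennreal 1 * indicator Q x)"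
  shows "(\<Sum>\<^sub>\<infinity>Q\<in>near_cubes_in \<D> \<gamma> E R. emeasure (dist_measure \<alpha> E) Q)
    \<le> ennreal C * emeasure (dist_measure \<alpha> E) R"
proof (rule ennreal_infsum_leI)
  interpret lattice_of_cubes \<D> using assms(1) by unfold_locales
  let ?\<mu> = "dist_measure \<alpha> E"
  let ?N = "near_cubes_in \<D> \<gamma> E R"
  fix H assume H: "finite H" "H \<subseteq> ?N"
  have [measurable]: "Q \<in> H \<Longrightarrow> Q \<in> sets borel" for Q
    using H cube_mem is_cube_borel by (auto simp: near_cubes_in_def near_cubes_def)
  have "(\<Sum>Q\<in>H. emeasure ?\<mu> Q) = (\<integral>\<^sup>+ x. (\<Sum>Q\<in>H. indicator Q x) \<partial>?\<mu>)"
    by (subst nn_integral_sum) auto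
  \<comment> \<open>The sum is exchanged with the integral for finite \<open>H\<close> only, so the
    infinite sum is used just as a pointwise majorant.\<close>
  also have "\<dots> \<le> (\<integral>\<^sup>+ x. (\<Sum>\<^sub>\<infinity>Q\<in>?N. indicator Q x) \<partial>?\<mu>)"
    using H by (intro nn_integral_mono ennreal_sum_le_infsum)
  also have "\<dots> \<le> ennreal C * (\<integral>\<^sup>+ x. (SUP Q\<in>?N. indicator Q x) \<partial>?\<mu>)"
    using le by (simp add: wnorm_def)
  also have "\<dots> \<le> ennreal C * (\<integral>\<^sup>+ x. indicator R x \<partial>?\<mu>)"
    by (intro mult_left_mono nn_integral_mono SUP_least) (auto simp: near_cubes_in_def indicator_def)
  also have "\<dots> = ennreal C * emeasure ?\<mu> R"
    using is_cube_borel[OF cube_mem[OF assms(2)]] by simp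
  finally show "(\<Sum>Q\<in>H. emeasure ?\<mu> Q) \<le> ennreal C * emeasure ?\<mu> R" .
qed

theorem corollary6:
  fixes \<D> :: "(real ^ 'n) set set" and E :: "(real ^ 'n) set" and \<gamma> :: real
  assumes "dyadic_lattice \<D>" and "E \<noteq> {}" and "\<gamma> > 0"
  shows
    "(porous \<D> E \<longleftrightarrow>
       (\<exists>\<alpha>>0. \<exists>\<zeta>>0. \<forall>R\<in>\<D>.
          (\<Sum>\<^sub>\<infinity>Q\<in>near_cubes_in \<D> \<gamma> E R. ennreal (measure lborel Q powr (1 - \<alpha> / real CARD('n))))
            \<le> ennreal (\<zeta> * measure lborel R powr (1 - \<alpha> / real CARD('n))))) \<and>
     (porous \<D> E \<longleftrightarrow>
       (emeasure lborel (closure E) = 0 \<and>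
        (\<exists>\<alpha>>0. dist_weight \<alpha> E \<and> (\<exists>\<xi>>0. \<forall>R\<in>\<D>.
          (\<Sum>\<^sub>\<infinity>Q\<in>near_cubes_in \<D> \<gamma> E R. emeasure (dist_measure \<alpha> E) Q)
            \<le> ennreal \<xi> * emeasure (dist_measure \<alpha> E) R)))) \<and>
     (porous \<D> E \<longleftrightarrow>
       (\<exists>\<alpha>>0. dist_weight \<alpha> E \<and> (\<forall>p\<ge>1. \<exists>C>0. \<forall>R\<in>\<D>. \<forall>a :: (real ^ 'n) set \<Rightarrow> real.
          (\<forall>Q\<in>near_cubes_in \<D> \<gamma> E R. 0 \<le> a Q) \<longrightarrow>
          wnorm p \<alpha> E (\<lambda>x. \<Sum>\<^sub>\<infinity>Q\<in>near_cubes_in \<D> \<gamma> E R. ennreal (a Q) * indicator Q x)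
            \<le> ennreal C *
              wnorm p \<alpha> E (\<lambda>x. SUP Q\<in>near_cubes_in \<D> \<gamma> E R. ennreal (a Q) * indicator Q x))))"
proof -
  note lattice = assms(1) and nonempty = assms(2) and \<gamma> = assms(3)
  let ?N = "near_cubes_in \<D> \<gamma> E"
  have "(\<exists>\<alpha>>0. \<exists>\<zeta>>0. \<forall>R\<in>\<D>.
      (\<Sum>\<^sub>\<infinity>Q\<in>?N R. ennreal (measure lborel Q powr (1 - \<alpha> / real CARD('n))))
        \<le> ennreal (\<zeta> * measure lborel R powr (1 - \<alpha> / real CARD('n)))) \<and>
    (emeasure lborel (closure E) = 0 \<and>
      (\<exists>\<alpha>>0. dist_weight \<alpha> E \<and> (\<exists>\<xi>>0. \<forall>R\<in>\<D>.
        (\<Sum>\<^sub>\<infinity>Q\<in>?N R. emeasure (dist_measure \<alpha> E) Q) \<le> ennreal \<xi> * emeasure (dist_measure \<alpha> E) R))) \<and>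
    (\<exists>\<alpha>>0. dist_weight \<alpha> E \<and> (\<forall>p\<ge>1. \<exists>C>0. \<forall>R\<in>\<D>. \<forall>a :: (real ^ 'n) set \<Rightarrow> real.
      (\<forall>Q\<in>?N R. 0 \<le> a Q) \<longrightarrow>
      wnorm p \<alpha> E (\<lambda>x. \<Sum>\<^sub>\<infinity>Q\<in>?N R. ennreal (a Q) * indicator Q x)
        \<le> ennreal C * wnorm p \<alpha> E (\<lambda>x. SUP Q\<in>?N R. ennreal (a Q) * indicator Q x)))"
    if por: "porous \<D> E"
  proof -
    obtain \<eta> where "porous_lattice \<D> E \<eta>" using porousE[OF lattice por] .
    then have null: "emeasure lborel (closure E) = 0" by (rule porous_lattice.closure_null)
    obtain \<alpha> \<zeta> where \<alpha>: "0 < \<alpha>" and \<zeta>: "0 < \<zeta>" and weight: "dist_weight \<alpha> E"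
      and i: "\<And>R. R \<in> \<D> \<Longrightarrow>
        (\<Sum>\<^sub>\<infinity>Q\<in>?N R. ennreal (measure lborel Q powr (1 - \<alpha> / real CARD('n))))
          \<le> ennreal (\<zeta> * measure lborel R powr (1 - \<alpha> / real CARD('n)))"
      and ii: "\<And>R. R \<in> \<D> \<Longrightarrow>
        (\<Sum>\<^sub>\<infinity>Q\<in>?N R. emeasure (dist_measure \<alpha> E) Q) \<le> ennreal \<zeta> * emeasure (dist_measure \<alpha> E) R"
      and iii: "\<And>p R a. 1 \<le> p \<Longrightarrow> R \<in> \<D> \<Longrightarrow> (\<And>Q. Q \<in> ?N R \<Longrightarrow> 0 \<le> a Q) \<Longrightarrow>
        wnorm p \<alpha> E (\<lambda>x. \<Sum>\<^sub>\<infinity>Q\<in>?N R. ennreal (a Q) * indicator Q x)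
          \<le> ennreal ((2 * (2 * (\<zeta> * p)) powr p) powr (1 / p)) *
            wnorm p \<alpha> E (\<lambda>x. SUP Q\<in>?N R. ennreal (a Q) * indicator Q x)"
      by (rule porous_imp_sums[OF lattice \<gamma> por]) (rule that; assumption | blast)
    \<comment> \<open>The exponent \<open>\<alpha>\<close> is fixed before \<open>p\<close>, and
      only the constant varies with \<open>p\<close>, as the quantifier order in (iii)
      demands.\<close>
    have "\<exists>C>0. \<forall>R\<in>\<D>. \<forall>a :: (real ^ 'n) set \<Rightarrow> real. (\<forall>Q\<in>?N R. 0 \<le> a Q) \<longrightarrow>
        wnorm p \<alpha> E (\<lambda>x. \<Sum>\<^sub>\<infinity>Q\<in>?N R. ennreal (a Q) * indicator Q x)
          \<le> ennreal C * wnorm p \<alpha> E (\<lambda>x. SUP Q\<in>?N R. ennreal (a Q) * indicator Q x)"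
      if "1 \<le> p" for p
    proof (intro exI conjI ballI allI impI)
      show "0 < (2 * (2 * (\<zeta> * p)) powr p) powr (1 / p)" using \<zeta> that by simp
    qed (use that in \<open>auto intro!: iii\<close>)
    then show ?thesis using null \<alpha> \<zeta> weight i ii by blast
  qed
  moreover have "porous \<D> E"
    if "\<exists>\<alpha>>0. \<exists>\<zeta>>0. \<forall>R\<in>\<D>.
      (\<Sum>\<^sub>\<infinity>Q\<in>?N R. ennreal (measure lborel Q powr (1 - \<alpha> / real CARD('n))))
        \<le> ennreal (\<zeta> * measure lborel R powr (1 - \<alpha> / real CARD('n)))"
    using that porous_of_powr_sum[OF assms] by blast
  moreover have "porous \<D> E"
    if "\<exists>\<alpha>>0. dist_weight \<alpha> E \<and> (\<exists>\<xi>>0. \<forall>R\<in>\<D>.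
        (\<Sum>\<^sub>\<infinity>Q\<in>?N R. emeasure (dist_measure \<alpha> E) Q) \<le> ennreal \<xi> * emeasure (dist_measure \<alpha> E) R)"
    using that porous_of_measure_sum[OF assms] by blast
  moreover have "porous \<D> E"
    if iii: "\<exists>\<alpha>>0. dist_weight \<alpha> E \<and> (\<forall>p\<ge>1. \<exists>C>0. \<forall>R\<in>\<D>. \<forall>a :: (real ^ 'n) set \<Rightarrow> real.
      (\<forall>Q\<in>?N R. 0 \<le> a Q) \<longrightarrow>
      wnorm p \<alpha> E (\<lambda>x. \<Sum>\<^sub>\<infinity>Q\<in>?N R. ennreal (a Q) * indicator Q x)
        \<le> ennreal C * wnorm p \<alpha> E (\<lambda>x. SUP Q\<in>?N R. ennreal (a Q) * indicator Q x))"
  proof -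
    obtain \<alpha> where weight: "dist_weight \<alpha> E"
      and "\<forall>p\<ge>1. \<exists>C>0. \<forall>R\<in>\<D>. \<forall>a :: (real ^ 'n) set \<Rightarrow> real. (\<forall>Q\<in>?N R. 0 \<le> a Q) \<longrightarrow>
        wnorm p \<alpha> E (\<lambda>x. \<Sum>\<^sub>\<infinity>Q\<in>?N R. ennreal (a Q) * indicator Q x)
          \<le> ennreal C * wnorm p \<alpha> E (\<lambda>x. SUP Q\<in>?N R. ennreal (a Q) * indicator Q x)"
      using iii by blast
    \<comment> \<open>Reflexivity of the order instantiates \<open>p\<close> with 1.\<close>
    from this(2)[rule_format, OF order_refl] obtain C where
      C: "\<forall>R\<in>\<D>. \<forall>a :: (real ^ 'n) set \<Rightarrow> real. (\<forall>Q\<in>?N R. 0 \<le> a Q) \<longrightarrow>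
        wnorm 1 \<alpha> E (\<lambda>x. \<Sum>\<^sub>\<infinity>Q\<in>?N R. ennreal (a Q) * indicator Q x)
          \<le> ennreal C * wnorm 1 \<alpha> E (\<lambda>x. SUP Q\<in>?N R. ennreal (a Q) * indicator Q x)"
      by blast
    show ?thesis
    proof (rule porous_of_measure_sum[OF assms weight])
      fix R assume R: "R \<in> \<D>"
      show "(\<Sum>\<^sub>\<infinity>Q\<in>?N R. emeasure (dist_measure \<alpha> E) Q) \<le> ennreal C * emeasure (dist_measure \<alpha> E) R"
        using C[rule_format, OF R, of "\<lambda>_. 1"] by (intro measure_sum_of_norm[OF lattice R]) simp
    qed
  qed
  ultimately show ?thesis by argo
qed

end
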